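(* Let $\theta_0\in\Theta$ and let $\Pi_n(\cdot\mid y)$, $n\ge 1$, $y\in\Omega$, be the a posteriori probability measures on $\Theta$ given by $$\Pi_n(E\mid y)=\frac{\int_E \mu_\theta(C_n(y))\,d\Pi_0(\theta)}{\int_\Theta \mu_\theta(C_n(y))\,d\Pi_0(\theta)},\qquad E\subset\Theta \text{ Borel}.$$ Then $$\lim_{n\to\infty}\Pi_n(\cdot\mid y)=\delta_{\theta_0}\quad\text{(in the weak$^*$ topology) for $\mu_{\theta_0}$-a.e. } y\in\Omega .$$ Moreover the convergence is exponentially fast: for every $\delta>0$ there exists a constant $c_\delta>0$ so that, writing $B_\delta=\{\theta\in\Theta: d_\Theta(\theta,\theta_0)<\delta\}$, for $\mu_{\theta_0}$-a.e. $y\in\Omega$ one has $|\Pi_n(B_\delta\mid y)-1|\le e^{-c_\delta n}$ for every large $n\ge 1$.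
   Context: $\Omega\subset\{1,\dots,q\}^{\mathbb N}$ is a transitive one-sided subshift of finite type (determined by a $0$-$1$ transition matrix), $\sigma:\Omega\to\Omega$ is the shift, with metric $d_\Omega(x,y)=2^{-n(x,y)}$, $n(x,y)=\inf\{n\ge1: x_n\ne y_n\}$. $C_n(y)=\{x\in\Omega: x_j=y_j,\ 1\le j\le n\}$ is the $n$-cylinder containing $y$. A Lipschitz continuous potential $\log J:\Omega\to\mathbb R$ ($J>0$) is normalized if $\sum_{\sigma(y)=x}J(y)=1$ for all $x\in\Omega$; its Gibbs measure $\mu_{\log J}$ is the unique $\sigma$-invariant Borel probability measure fixed by the dual $\mathcal L_{\log J}^*$ of the transfer operator $\mathcal L_{\log J}g(x)=\sum_{\sigma(y)=x}J(y)g(y)$. The parameter space is $\Theta=[a_1,b_1]\times\cdots\times[a_k,b_k]\subset\mathbb R^k$ with $d_\Theta(\theta_1,\theta_2)=\|\theta_1-\theta_2\|$. There is a map $f$, $\theta\mapsto f(\theta)=\log J_\theta$, from $\Theta$ to the space of Lipschitz continuous normalized potentials on $\Omega$ (with the Lipschitz norm $\|\cdot\|_\infty+|\cdot|_{Lip}$), which is continuous and a homeomorphism onto its image; $\mu_\theta$ denotes the Gibbs measure of $\log J_\theta$. The a priori measure $\Pi_0$ is a probability measure on $\Theta$ with a continuous strictly positive density (with respect to Lebesgue measure), fully supported on $\Theta$. The measures $\Pi_n(\cdot\mid y)$ are the Gibbs posterior measures $\Pi_n(E\mid y)=\frac{1}{Z_n(y)}\int_E\int_\Omega e^{-\ell_n(\theta,x,y)}d\mu_\theta(x)\,d\Pi_0(\theta)$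 (with $Z_n(y)$ the normalizing constant) for the loss functions $\ell_n(\theta,x,y)=\log\mu_{\theta_0}(C_n(y))$ if $x\in C_n(y)$ and $+\infty$ otherwise. *)

theory Defs
  imports "HOL-Probability.Probability"
begin

text \<open>Sequences are indexed from 0: the coordinate \<open>x\<^sub>j\<close>, \<open>j \<ge> 1\<close>, of a point of
  \<open>{1,\<dots>,q}\<^sup>\<nat>\<close> is \<open>x (j - 1)\<close>.\<close>

definition sft :: "nat \<Rightarrow> (nat \<Rightarrow> nat \<Rightarrow> nat) \<Rightarrow> (nat \<Rightarrow> nat) set" where
  "sft q A = {x. \<forall>j. x j \<in> {1..q} \<and> A (x j) (x (Suc j)) = 1}"

definition shift :: "(nat \<Rightarrow> nat) \<Rightarrow> (nat \<Rightarrow> nat)" where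
  "shift x = (\<lambda>j. x (Suc j))"

text \<open>The exponent is the first (1-based) coordinate at which the sequences differ.\<close>

definition seq_dist :: "(nat \<Rightarrow> nat) \<Rightarrow> (nat \<Rightarrow> nat) \<Rightarrow> real" where
  "seq_dist x y = (if x = y then 0 else (1/2) ^ Suc (LEAST j. x j \<noteq> y j))"

definition seq_metric :: "(nat \<Rightarrow> nat) set \<Rightarrow> (nat \<Rightarrow> nat) metric" where
  "seq_metric X = metric (X, seq_dist)"

definition seq_topology :: "(nat \<Rightarrow> nat) set \<Rightarrow> (nat \<Rightarrow> nat) topology" where
  "seq_topology X = mtopology_of (seq_metric X)"

definition seq_borel :: "(nat \<Rightarrow> nat) set \<Rightarrow> (nat \<Rightarrow> nat) measure" where
  "seq_borel X = sigma X {U. openin (seq_topology X) U}"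

definition topologically_transitive :: "(nat \<Rightarrow> nat) set \<Rightarrow> bool" where
  "topologically_transitive X \<longleftrightarrow>
     (\<forall>U V. openin (seq_topology X) U \<and> openin (seq_topology X) V \<and> U \<noteq> {} \<and> V \<noteq> {} \<longrightarrow>
        (\<exists>n. (shift ^^ n) ` U \<inter> V \<noteq> {}))"

definition cylinder :: "(nat \<Rightarrow> nat) set \<Rightarrow> nat \<Rightarrow> (nat \<Rightarrow> nat) \<Rightarrow> (nat \<Rightarrow> nat) set" where
  "cylinder X n y = {x \<in> X. \<forall>j<n. x j = y j}"

lemma Metric_space_seq_dist: "Metric_space X seq_dist"
proof
  fix x y z :: "nat \<Rightarrow> nat"
  show "0 \<le> seq_dist x y"
    by (simp add: seq_dist_def)
  show "seq_dist x y = seq_dist y x"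
    unfolding seq_dist_def by (simp add: eq_commute)
  show "seq_dist x y = 0 \<longleftrightarrow> x = y"
    by (simp add: seq_dist_def)
  show "seq_dist x z \<le> seq_dist x y + seq_dist y z"
  proof (cases "x = y \<or> y = z \<or> x = z")
    case True
    then show ?thesis by (auto simp: seq_dist_def)
  next
    case False
    define a b c where "a = (LEAST j. x j \<noteq> y j)" and "b = (LEAST j. y j \<noteq> z j)"
      and "c = (LEAST j. x j \<noteq> z j)"
    have "\<exists>j. x j \<noteq> z j" using False by auto
    then have "x c \<noteq> z c" unfolding c_def by (rule LeastI_ex)
    then consider "x c \<noteq> y c" | "y c \<noteq> z c" by metis
    then have "a \<le> c \<or> b \<le> c"
      by cases (auto simp: a_def b_def intro: Least_le)
    then have "(1/2::real) ^ Suc c \<le> (1/2) ^ Suc a \<or> (1/2::real) ^ Suc c \<le> (1/2) ^ Suc b"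
      using power_decreasing[of "Suc a" "Suc c" "1/2::real"]
        power_decreasing[of "Suc b" "Suc c" "1/2::real"] by auto
    moreover have "0 \<le> (1/2::real) ^ Suc a" "0 \<le> (1/2::real) ^ Suc b" by simp_all
    ultimately have "(1/2::real) ^ Suc c \<le> (1/2) ^ Suc a + (1/2) ^ Suc b"
      by linarith
    then show ?thesis
      using False by (simp add: seq_dist_def a_def b_def c_def del: power_Suc)
  qed
qed

lemma mspace_seq_metric [simp]: "mspace (seq_metric X) = X"
  and mdist_seq_metric [simp]: "mdist (seq_metric X) = seq_dist"
  using Metric_space_seq_dist[of X]
  by (simp_all add: seq_metric_def Metric_space.mspace_metric Metric_space.mdist_metric)

text \<open>The sum is finite for \<open>X \<subseteq> {1,\<dots>,q}\<^sup>\<nat>\<close>: a point has at most \<open>q\<close> preimages.\<close>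

definition transfer_op ::
    "(nat \<Rightarrow> nat) set \<Rightarrow> ((nat \<Rightarrow> nat) \<Rightarrow> real) \<Rightarrow> ((nat \<Rightarrow> nat) \<Rightarrow> real) \<Rightarrow> (nat \<Rightarrow> nat) \<Rightarrow> real" where
  "transfer_op X \<phi> g x = (\<Sum>y | y \<in> X \<and> shift y = x. exp (\<phi> y) * g y)"

lemma finite_preimages_sft: "finite {y. y \<in> sft q A \<and> shift y = x}"
proof (rule finite_subset)
  show "{y. y \<in> sft q A \<and> shift y = x} \<subseteq> (\<lambda>i. case_nat i x) ` {1..q}"
  proof
    fix y assume y: "y \<in> {y. y \<in> sft q A \<and> shift y = x}"
    then have "y = case_nat (y 0) x"
      by (auto simp: shift_def fun_eq_iff split: nat.split)
    moreover have "y 0 \<in> {1..q}" using y by (auto simp: sft_def)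
    ultimately show "y \<in> (\<lambda>i. case_nat i x) ` {1..q}" by blast
  qed
qed simp

text \<open>A potential \<open>log J\<close> on \<open>X\<close> is represented by its extensional extension, so that two potentials
  are equal iff they agree on \<open>X\<close>.\<close>

definition normalized_potentials :: "(nat \<Rightarrow> nat) set \<Rightarrow> ((nat \<Rightarrow> nat) \<Rightarrow> real) set" where
  "normalized_potentials X =
     {\<phi> \<in> extensional X. Lipschitz_continuous_map (seq_metric X) euclidean_metric \<phi> \<and>
        (\<forall>x\<in>X. (\<Sum>y | y \<in> X \<and> shift y = x. exp (\<phi> y)) = 1)}"

text \<open>Pairs with \<open>x = y\<close> contribute \<open>0 / 0 = 0\<close> to the second supremum.\<close>

definition lip_norm :: "(nat \<Rightarrow> nat) set \<Rightarrow> ((nat \<Rightarrow> nat) \<Rightarrow> real) \<Rightarrow> real" where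
  "lip_norm X g = (SUP x\<in>X. \<bar>g x\<bar>) + (SUP (x, y)\<in>X \<times> X. \<bar>g x - g y\<bar> / seq_dist x y)"

text \<open>The value 0 outside the carrier only serves to satisfy the totality requirements of
  \<^locale>\<open>Metric_space\<close>.\<close>

definition potential_dist ::
    "(nat \<Rightarrow> nat) set \<Rightarrow> ((nat \<Rightarrow> nat) \<Rightarrow> real) \<Rightarrow> ((nat \<Rightarrow> nat) \<Rightarrow> real) \<Rightarrow> real" where
  "potential_dist X \<phi> \<psi> =
     (if \<phi> \<in> normalized_potentials X \<and> \<psi> \<in> normalized_potentials X
      then lip_norm X (\<lambda>x. \<phi> x - \<psi> x) else 0)"

definition potential_metric :: "(nat \<Rightarrow> nat) set \<Rightarrow> ((nat \<Rightarrow> nat) \<Rightarrow> real) metric" where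
  "potential_metric X = metric (normalized_potentials X, potential_dist X)"

lemma lip_norm_bdd:
  assumes "X \<noteq> {}" "\<phi> \<in> normalized_potentials X" "\<psi> \<in> normalized_potentials X"
  shows "bdd_above ((\<lambda>x. \<bar>\<phi> x - \<psi> x\<bar>) ` X)"
    and "bdd_above ((\<lambda>(x, y). \<bar>(\<phi> x - \<psi> x) - (\<phi> y - \<psi> y)\<bar> / seq_dist x y) ` (X \<times> X))"
proof -
  interpret Metric_space X seq_dist by (rule Metric_space_seq_dist)
  obtain B where B: "\<And>x y. x \<in> X \<Longrightarrow> y \<in> X \<Longrightarrow> \<bar>\<phi> x - \<phi> y\<bar> \<le> B * seq_dist x y"
    using assms(2) unfolding normalized_potentials_def Lipschitz_continuous_map_def
    by (auto simp: dist_real_def)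
  obtain C where C: "\<And>x y. x \<in> X \<Longrightarrow> y \<in> X \<Longrightarrow> \<bar>\<psi> x - \<psi> y\<bar> \<le> C * seq_dist x y"
    using assms(3) unfolding normalized_potentials_def Lipschitz_continuous_map_def
    by (auto simp: dist_real_def)
  have D: "\<bar>(\<phi> x - \<psi> x) - (\<phi> y - \<psi> y)\<bar> \<le> (B + C) * seq_dist x y" if "x \<in> X" "y \<in> X" for x y
    using B[OF that] C[OF that] by (simp add: distrib_right)
  have le1: "seq_dist x y \<le> 1" for x y
    by (simp add: seq_dist_def power_le_one del: power_Suc)
  obtain z where z: "z \<in> X" using assms(1) by auto
  show "bdd_above ((\<lambda>x. \<bar>\<phi> x - \<psi> x\<bar>) ` X)"
  proof (rule bdd_aboveI2)
    fix x assume x: "x \<in> X"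
    have "(B + C) * seq_dist x z \<le> \<bar>B + C\<bar> * 1"
      by (intro mult_mono) (auto simp: le1)
    then show "\<bar>\<phi> x - \<psi> x\<bar> \<le> \<bar>B + C\<bar> + \<bar>\<phi> z - \<psi> z\<bar>"
      using order_trans[OF D[OF x z]] abs_triangle_ineq2[of "\<phi> x - \<psi> x" "\<phi> z - \<psi> z"]
      by fastforce
  qed
  show "bdd_above ((\<lambda>(x, y). \<bar>(\<phi> x - \<psi> x) - (\<phi> y - \<psi> y)\<bar> / seq_dist x y) ` (X \<times> X))"
  proof (rule bdd_aboveI2)
    fix p assume p: "p \<in> X \<times> X"
    obtain x y where xy: "p = (x, y)" "x \<in> X" "y \<in> X" using p by auto
    show "(case p of (x, y) \<Rightarrow> \<bar>(\<phi> x - \<psi> x) - (\<phi> y - \<psi> y)\<bar> / seq_dist x y) \<le> \<bar>B + C\<bar>"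
    proof (cases "x = y")
      case False
      then have pos: "seq_dist x y > 0" by (simp add: seq_dist_def)
      have "\<bar>(\<phi> x - \<psi> x) - (\<phi> y - \<psi> y)\<bar> \<le> \<bar>B + C\<bar> * seq_dist x y"
        using D[OF xy(2,3)] mult_right_mono[OF abs_ge_self[of "B + C"], of "seq_dist x y"] pos
        by linarith
      then show ?thesis using pos by (simp add: xy(1) divide_le_eq)
    qed (simp add: xy(1))
  qed
qed

lemma Metric_space_potential_dist:
  assumes X: "X \<noteq> {}"
  shows "Metric_space (normalized_potentials X) (potential_dist X)"
proof -
  let ?P = "normalized_potentials X"
  let ?Q = "\<lambda>\<phi> \<psi>. \<lambda>(x, y). \<bar>(\<phi> x - \<psi> x) - (\<phi> y - \<psi> y)\<bar> / seq_dist x y"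
  obtain z where z: "z \<in> X" using X by auto
  have quot: "(SUP p\<in>X \<times> X. ?Q \<phi> \<psi> p) \<ge> 0" if "\<phi> \<in> ?P" "\<psi> \<in> ?P" for \<phi> \<psi>
    using cSUP_upper2[OF lip_norm_bdd(2)[OF X that], of "(z, z)" 0] z by auto
  have sup: "\<bar>\<phi> x - \<psi> x\<bar> \<le> (SUP x\<in>X. \<bar>\<phi> x - \<psi> x\<bar>)" if "\<phi> \<in> ?P" "\<psi> \<in> ?P" "x \<in> X" for \<phi> \<psi> x
    using cSUP_upper[OF that(3) lip_norm_bdd(1)[OF X that(1,2)]] .
  have sup0: "0 \<le> (SUP x\<in>X. \<bar>\<phi> x - \<psi> x\<bar>)" if "\<phi> \<in> ?P" "\<psi> \<in> ?P" for \<phi> \<psi>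
    using sup[OF that z] by linarith
  have nonneg: "0 \<le> lip_norm X (\<lambda>x. \<phi> x - \<psi> x)" if "\<phi> \<in> ?P" "\<psi> \<in> ?P" for \<phi> \<psi>
    unfolding lip_norm_def using sup0[OF that] quot[OF that] by linarith
  have zero: "lip_norm X (\<lambda>x. \<phi> x - \<psi> x) = 0 \<longleftrightarrow> \<phi> = \<psi>" if "\<phi> \<in> ?P" "\<psi> \<in> ?P" for \<phi> \<psi>
  proof
    assume "lip_norm X (\<lambda>x. \<phi> x - \<psi> x) = 0"
    then have "(SUP x\<in>X. \<bar>\<phi> x - \<psi> x\<bar>) = 0"
      unfolding lip_norm_def using sup0[OF that] quot[OF that] by linarith
    then have "\<phi> x = \<psi> x" if "x \<in> X" for x
      using sup[OF \<open>\<phi> \<in> ?P\<close> \<open>\<psi> \<in> ?P\<close> that] by simp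
    then show "\<phi> = \<psi>"
      using that by (intro extensionalityI[of _ X]) (auto simp: normalized_potentials_def)
  next
    assume "\<phi> = \<psi>"
    then show "lip_norm X (\<lambda>x. \<phi> x - \<psi> x) = 0"
      using X by (simp add: lip_norm_def case_prod_beta)
  qed
  have tri: "lip_norm X (\<lambda>x. \<phi> x - \<eta> x) \<le> lip_norm X (\<lambda>x. \<phi> x - \<psi> x) + lip_norm X (\<lambda>x. \<psi> x - \<eta> x)"
    if P: "\<phi> \<in> ?P" "\<psi> \<in> ?P" "\<eta> \<in> ?P" for \<phi> \<psi> \<eta>
  proof -
    have "(SUP x\<in>X. \<bar>\<phi> x - \<eta> x\<bar>) \<le> (SUP x\<in>X. \<bar>\<phi> x - \<psi> x\<bar>) + (SUP x\<in>X. \<bar>\<psi> x - \<eta> x\<bar>)"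
    proof (rule cSUP_least[OF X])
      fix x assume "x \<in> X"
      from sup[OF P(1,2) this] sup[OF P(2,3) this]
      show "\<bar>\<phi> x - \<eta> x\<bar> \<le> (SUP x\<in>X. \<bar>\<phi> x - \<psi> x\<bar>) + (SUP x\<in>X. \<bar>\<psi> x - \<eta> x\<bar>)" by linarith
    qed
    moreover have "(SUP p\<in>X \<times> X. ?Q \<phi> \<eta> p) \<le> (SUP p\<in>X \<times> X. ?Q \<phi> \<psi> p) + (SUP p\<in>X \<times> X. ?Q \<psi> \<eta> p)"
    proof (rule cSUP_least)
      show "X \<times> X \<noteq> {}" using X by auto
      fix p assume p: "p \<in> X \<times> X"
      obtain x y where xy: "p = (x, y)" by (cases p)
      have "0 \<le> seq_dist x y" by (simp add: seq_dist_def)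
      then have "?Q \<phi> \<eta> p \<le> ?Q \<phi> \<psi> p + ?Q \<psi> \<eta> p"
        unfolding xy prod.case add_divide_distrib[symmetric]
        by (intro divide_right_mono) linarith+
      also have "\<dots> \<le> (SUP p\<in>X \<times> X. ?Q \<phi> \<psi> p) + (SUP p\<in>X \<times> X. ?Q \<psi> \<eta> p)"
        using cSUP_upper[OF p lip_norm_bdd(2)[OF X P(1,2)]]
          cSUP_upper[OF p lip_norm_bdd(2)[OF X P(2,3)]] by (rule add_mono)
      finally show "?Q \<phi> \<eta> p \<le> (SUP p\<in>X \<times> X. ?Q \<phi> \<psi> p) + (SUP p\<in>X \<times> X. ?Q \<psi> \<eta> p)" .
    qed
    ultimately show ?thesis unfolding lip_norm_def by linarith
  qed
  have sym: "lip_norm X (\<lambda>x. \<phi> x - \<psi> x) = lip_norm X (\<lambda>x. \<psi> x - \<phi> x)" for \<phi> \<psi>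
  proof -
    have "\<bar>(\<phi> x - \<psi> x) - (\<phi> y - \<psi> y)\<bar> = \<bar>(\<psi> x - \<phi> x) - (\<psi> y - \<phi> y)\<bar>" for x y
      by linarith
    then show ?thesis unfolding lip_norm_def by (simp add: abs_minus_commute)
  qed
  show ?thesis
    by unfold_locales (use nonneg zero tri sym in \<open>auto simp: potential_dist_def\<close>)
qed

lemma
  assumes "X \<noteq> {}"
  shows mspace_potential_metric [simp]: "mspace (potential_metric X) = normalized_potentials X"
    and mdist_potential_metric [simp]: "mdist (potential_metric X) = potential_dist X"
  using Metric_space_potential_dist[OF assms]
  by (simp_all add: potential_metric_def Metric_space.mspace_metric Metric_space.mdist_metric)

text \<open>On a transitive subshift of finite type, a normalized Lipschitz potential has exactly one
  Gibbs measure in this sense.\<close>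

definition gibbs_measure ::
    "(nat \<Rightarrow> nat) set \<Rightarrow> ((nat \<Rightarrow> nat) \<Rightarrow> real) \<Rightarrow> (nat \<Rightarrow> nat) measure \<Rightarrow> bool" where
  "gibbs_measure X \<phi> m \<longleftrightarrow>
     prob_space m \<and> sets m = sets (seq_borel X) \<and>
     distr m (seq_borel X) shift = m \<and>
     (\<forall>g. continuous_map (seq_topology X) euclideanreal g \<longrightarrow>
        (\<integral>x. transfer_op X \<phi> g x \<partial>m) = (\<integral>x. g x \<partial>m))"

definition posterior ::
    "(nat \<Rightarrow> nat) set \<Rightarrow> ('p \<Rightarrow> (nat \<Rightarrow> nat) measure) \<Rightarrow> 'p measure \<Rightarrow> nat \<Rightarrow> (nat \<Rightarrow> nat) \<Rightarrow> 'p measure"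
  where
  "posterior X \<mu> \<Pi>\<^sub>0 n y =
     density \<Pi>\<^sub>0 (\<lambda>\<theta>. ennreal (measure (\<mu> \<theta>) (cylinder X n y) /
       (\<integral>\<theta>'. measure (\<mu> \<theta>') (cylinder X n y) \<partial>\<Pi>\<^sub>0)))"

lemma measure_posterior:
  assumes \<Pi>\<^sub>0: "prob_space \<Pi>\<^sub>0" and \<mu>: "\<And>\<theta>. \<theta> \<in> space \<Pi>\<^sub>0 \<Longrightarrow> prob_space (\<mu> \<theta>)"
    and meas: "(\<lambda>\<theta>. measure (\<mu> \<theta>) (cylinder X n y)) \<in> borel_measurable \<Pi>\<^sub>0"
    and E: "E \<in> sets \<Pi>\<^sub>0"
  shows "measure (posterior X \<mu> \<Pi>\<^sub>0 n y) E =
    (LINT \<theta>:E|\<Pi>\<^sub>0. measure (\<mu> \<theta>) (cylinder X n y)) / (LINT \<theta>|\<Pi>\<^sub>0. measure (\<mu> \<theta>) (cylinder X n y))"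
proof -
  interpret prob_space \<Pi>\<^sub>0 by (rule \<Pi>\<^sub>0)
  let ?h = "\<lambda>\<theta>. measure (\<mu> \<theta>) (cylinder X n y)"
  let ?Z = "\<integral>\<theta>. ?h \<theta> \<partial>\<Pi>\<^sub>0"
  have int: "integrable \<Pi>\<^sub>0 ?h"
    by (rule integrable_const_bound[of _ 1]) (auto simp: meas \<mu> prob_space.prob_le_1)
  have Z: "0 \<le> ?Z" by simp
  have intE: "integrable \<Pi>\<^sub>0 (\<lambda>\<theta>. indicator E \<theta> * (?h \<theta> / ?Z))"
    using integrable_mult_indicator[OF E integrable_divide[OF int, of ?Z]] by simp
  have "emeasure (posterior X \<mu> \<Pi>\<^sub>0 n y) E = (\<integral>\<^sup>+\<theta>. ennreal (?h \<theta> / ?Z) * indicator E \<theta> \<partial>\<Pi>\<^sub>0)"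
    unfolding posterior_def using meas E by (intro emeasure_density) auto
  also have "\<dots> = (\<integral>\<^sup>+\<theta>. ennreal (indicator E \<theta> * (?h \<theta> / ?Z)) \<partial>\<Pi>\<^sub>0)"
    by (intro nn_integral_cong) (auto simp: indicator_def)
  also have "\<dots> = ennreal (\<integral>\<theta>. indicator E \<theta> * (?h \<theta> / ?Z) \<partial>\<Pi>\<^sub>0)"
    using Z by (intro nn_integral_eq_integral[OF intE]) auto
  also have "(\<integral>\<theta>. indicator E \<theta> * (?h \<theta> / ?Z) \<partial>\<Pi>\<^sub>0) = (\<integral>\<theta>. indicator E \<theta> * ?h \<theta> \<partial>\<Pi>\<^sub>0) / ?Z"
    by simp
  finally show ?thesis
    using Z unfolding measure_def
    by (simp add: set_lebesgue_integral_def enn2real_ennreal)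
qed

text \<open>Weak* convergence of measures on a compact set \<open>T\<close>, where every continuous function is
  bounded.\<close>

definition weak_star_tendsto ::
    "'p::topological_space set \<Rightarrow> (nat \<Rightarrow> 'p measure) \<Rightarrow> 'p measure \<Rightarrow> bool" where
  "weak_star_tendsto T P Q \<longleftrightarrow>
     (\<forall>g. continuous_on T g \<longrightarrow> (\<lambda>n. \<integral>\<theta>. g \<theta> \<partial>P n) \<longlonglongrightarrow> (\<integral>\<theta>. (g \<theta> :: real) \<partial>Q))"

end

theory Submission
  imports Defs
begin

text \<open>Write \<open>\<phi>\<close> for the true potential \<open>f \<theta>\<^sub>0\<close>, \<open>S\<^sub>n\<close> for Birkhoff sums and \<open>L\<^sub>\<psi>\<close> for the
  transfer operator of a potential \<open>\<psi>\<close>. The posterior mass outside a ball is a quotient of two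
  averages of \<open>\<mu>\<^sub>\<theta>(C\<^sub>n(y))\<close> over the prior, and both are compared with \<open>exp (S\<^sub>n\<phi>(y))\<close>. The
  exponential rate comes from the strict decrease of a transfer operator that interpolates between the
  true potential and a competing one.

  The link between measures and potentials is the Gibbs property. Integrating
  \<open>L\<^sup>n 1\<^bsub>C\<^esub>\<close> over the Gibbs measure shows that the measure of an \<open>n\<close>-cylinder is
  \<open>exp (S\<^sub>n f\<^sub>\<theta>(y))\<close> up to a bounded factor (\<open>measure_cylinder_le\<close>, \<open>measure_cylinder_ge\<close>, and
  \<open>symbol_measure_ge\<close> for the last symbol). If
  \<open>f\<^sub>\<theta>\<close> is replaced by a potential at sup-distance \<open>\<eta>\<close>, a factor \<open>exp (\<plusminus>n\<eta>)\<close> is lost. Hence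
  the parameters near \<open>\<theta>\<^sub>0\<close>, which have positive prior mass, give the denominator at least
  \<open>K exp (S\<^sub>n\<phi>(y) - \<eta>n)\<close> for every \<open>y\<close>, with \<open>\<eta> > 0\<close> as small as desired
  (\<open>evidence_lower_bound\<close>).

  For the numerator let \<open>\<xi> = f \<theta>\<close> with \<open>\<theta> \<noteq> \<theta>\<^sub>0\<close>, so that \<open>\<xi> \<noteq> \<phi>\<close> somewhere, and put
  \<open>\<psi> = (\<phi> + \<xi>)/2\<close>. Invariance under \<open>L\<^sub>\<phi>\<close> turns the integral of \<open>exp ((S\<^sub>n\<xi> - S\<^sub>n\<phi>)/2)\<close> against
  \<open>\<mu>\<close> at \<open>\<theta>\<^sub>0\<close> into the integral of \<open>L\<^sub>\<psi>\<^sup>n 1\<close> (\<open>integral_root_ratio\<close>); this is the Hellinger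
  affinity of the two measures on \<open>n\<close>-cylinders, up to a bounded factor. Normalization and the
  inequality of arithmetic and geometric means give \<open>L\<^sub>\<psi> 1 \<le> 1\<close>, with strict inequality
  on a cylinder. By transitivity every point has a preimage of bounded order in that cylinder, so
  some iterate satisfies \<open>L\<^sub>\<psi>\<^sup>N 1 \<le> r < 1\<close> everywhere and the integral decays exponentially
  (\<open>affinity_decay\<close>). Markov's inequality and the Borel-Cantelli lemma give
  \<open>S\<^sub>n\<xi>(y) \<le> S\<^sub>n\<phi>(y) - cn\<close> eventually, for almost every \<open>y\<close> (\<open>AE_birkhoff_sum_gap\<close>).
  The parameters outside a ball around \<open>\<theta>\<^sub>0\<close> form a compact set, so finitely many such \<open>\<xi>\<close> control
  all of them at once (\<open>likelihood_upper_bound\<close>).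

  The posterior is a genuine measure only if \<open>\<mu>\<^sub>\<theta>(C\<^sub>n(y))\<close> is a measurable function of \<open>\<theta>\<close>, which
  rests on the uniqueness of Gibbs measures. The iterates of the lazy operator
  \<open>(1 + L)/2\<close> contract a combination of oscillation and Lipschitz constant, so
  at any point they converge to the integral against the Gibbs measure
  (\<open>lazy_op_funpow_tendsto_integral\<close>). Each iterate is continuous in \<open>\<theta>\<close>, so the limit is
  measurable.\<close>

section \<open>The metric and the shift\<close>

lemma seq_dist_nonneg: "0 \<le> seq_dist x y"
  by (simp add: seq_dist_def)

lemma seq_dist_le_iff: "seq_dist x y \<le> (1/2) ^ Suc n \<longleftrightarrow> (\<forall>j<n. x j = y j)"
proof (cases "x = y")
  case False
  define l where "l = (LEAST j. x j \<noteq> y j)"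
  have "\<exists>j. x j \<noteq> y j" using False by auto
  then have l: "x l \<noteq> y l" unfolding l_def by (rule LeastI_ex)
  have low: "x j = y j" if "j < l" for j
    using not_less_Least that unfolding l_def by blast
  have "seq_dist x y \<le> (1/2) ^ Suc n \<longleftrightarrow> n \<le> l"
    using False power_decreasing_iff[of "1/2::real" "Suc l" "Suc n"]
    by (simp add: seq_dist_def l_def del: power_Suc)
  also have "\<dots> \<longleftrightarrow> (\<forall>j<n. x j = y j)"
    using l low by (metis less_le_trans not_le)
  finally show ?thesis .
qed (simp add: seq_dist_def)

lemma seq_dist_le_half: "seq_dist x y \<le> 1/2"
  using seq_dist_le_iff[of x y 0] by simp

lemma seq_dist_cases:
  obtains "x = y" | n where "seq_dist x y = (1/2) ^ Suc n" "\<forall>j<n. x j = y j"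
proof (cases "x = y")
  case False
  then have "seq_dist x y = (1/2) ^ Suc (LEAST j. x j \<noteq> y j)"
    by (simp add: seq_dist_def)
  then show ?thesis using that seq_dist_le_iff by (metis order_refl)
qed

lemma seq_dist_shift: "seq_dist (shift x) (shift y) \<le> 2 * seq_dist x y"
proof (cases x y rule: seq_dist_cases)
  case (2 n)
  then have "seq_dist (shift x) (shift y) \<le> (1/2) ^ Suc (n - 1)"
    unfolding seq_dist_le_iff shift_def by auto
  also have "\<dots> \<le> 2 * (1/2) ^ Suc n"
    by (cases n) auto
  finally show ?thesis using 2 by simp
qed (simp add: seq_dist_def)

text \<open>Passing to a preimage under the shift halves distances. This is the source of the contraction in
  every estimate for the transfer operator.\<close>

lemma seq_dist_case_nat: "seq_dist (case_nat i x) (case_nat i y) \<le> seq_dist x y / 2"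
proof (cases x y rule: seq_dist_cases)
  case (2 n)
  then have "seq_dist (case_nat i x) (case_nat i y) \<le> (1/2) ^ Suc (Suc n)"
    unfolding seq_dist_le_iff by (auto split: nat.split)
  then show ?thesis using 2 by simp
qed (simp add: seq_dist_def)

lemma shift_funpow: "(shift ^^ n) x = (\<lambda>j. x (j + n))"
  by (induction n arbitrary: x) (auto simp: shift_def)

lemma case_nat_shift: "case_nat (y 0) (shift y) = y"
  by (auto simp: shift_def fun_eq_iff split: nat.split)

section \<open>Bounded Lipschitz functions\<close>

text \<open>The sup bound is part of the class because products and exponentials of Lipschitz functions need it to
  be Lipschitz again. One constant serves for both bounds.\<close>

definition bounded_lipschitz :: "(nat \<Rightarrow> nat) set \<Rightarrow> ((nat \<Rightarrow> nat) \<Rightarrow> real) \<Rightarrow> bool" where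
  "bounded_lipschitz X g \<longleftrightarrow>
     (\<exists>B. \<forall>x\<in>X. \<forall>y\<in>X. \<bar>g x\<bar> \<le> B \<and> \<bar>g x - g y\<bar> \<le> B * seq_dist x y)"

lemma bounded_lipschitzE:
  assumes "bounded_lipschitz X g"
  obtains B where "B > 0" "\<And>x. x \<in> X \<Longrightarrow> \<bar>g x\<bar> \<le> B"
    "\<And>x y. x \<in> X \<Longrightarrow> y \<in> X \<Longrightarrow> \<bar>g x - g y\<bar> \<le> B * seq_dist x y"
proof -
  obtain B where B: "\<forall>x\<in>X. \<forall>y\<in>X. \<bar>g x\<bar> \<le> B \<and> \<bar>g x - g y\<bar> \<le> B * seq_dist x y"
    using assms unfolding bounded_lipschitz_def by blast
  have "\<bar>g x - g y\<bar> \<le> (\<bar>B\<bar> + 1) * seq_dist x y" if "x \<in> X" "y \<in> X" for x y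
    using B that mult_right_mono[of B "\<bar>B\<bar> + 1" "seq_dist x y"] seq_dist_nonneg[of x y]
    by fastforce
  moreover have "\<bar>g x\<bar> \<le> \<bar>B\<bar> + 1" if "x \<in> X" for x
    using B that by fastforce
  ultimately show ?thesis using that[of "\<bar>B\<bar> + 1"] by auto
qed

lemma bounded_lipschitzI:
  assumes "\<And>x. x \<in> X \<Longrightarrow> \<bar>g x\<bar> \<le> B"
    and "\<And>x y. x \<in> X \<Longrightarrow> y \<in> X \<Longrightarrow> \<bar>g x - g y\<bar> \<le> C * seq_dist x y"
  shows "bounded_lipschitz X g"
  unfolding bounded_lipschitz_def
proof (intro exI[of _ "max B C"] ballI conjI)
  fix x y assume "x \<in> X" "y \<in> X"
  then show "\<bar>g x\<bar> \<le> max B C" using assms(1) by fastforce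
  have "C * seq_dist x y \<le> max B C * seq_dist x y"
    by (intro mult_right_mono seq_dist_nonneg) simp
  then show "\<bar>g x - g y\<bar> \<le> max B C * seq_dist x y"
    using assms(2)[OF \<open>x \<in> X\<close> \<open>y \<in> X\<close>] by linarith
qed

text \<open>Only pairs with a common first symbol need a Lipschitz estimate, because any other pair is
  at distance \<open>1/2\<close>.\<close>

lemma bounded_lipschitzI_same_symbol:
  assumes "\<And>x. x \<in> X \<Longrightarrow> \<bar>g x\<bar> \<le> B" and "0 \<le> C"
    and "\<And>x y. x \<in> X \<Longrightarrow> y \<in> X \<Longrightarrow> x 0 = y 0 \<Longrightarrow> \<bar>g x - g y\<bar> \<le> C * seq_dist x y"
  shows "bounded_lipschitz X g"
proof (rule bounded_lipschitzI[OF assms(1)])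
  fix x y assume xy: "x \<in> X" "y \<in> X"
  have B: "0 \<le> B" using assms(1)[OF xy(1)] by simp
  show "\<bar>g x - g y\<bar> \<le> (C + 4 * B) * seq_dist x y"
  proof (cases "x 0 = y 0")
    case True
    have "C * seq_dist x y \<le> (C + 4 * B) * seq_dist x y"
      using B by (intro mult_right_mono seq_dist_nonneg) auto
    then show ?thesis using assms(3)[OF xy True] by linarith
  next
    case False
    then have d: "seq_dist x y = 1/2"
      using Least_eq_0[of "\<lambda>j. x j \<noteq> y j"] by (auto simp: seq_dist_def)
    have "\<bar>g x - g y\<bar> \<le> 2 * B"
      using assms(1)[OF xy(1)] assms(1)[OF xy(2)] by linarith
    then show ?thesis using assms(2) unfolding d by (simp add: field_simps)
  qed
qed auto

lemma bounded_lipschitz_const: "bounded_lipschitz X (\<lambda>x. c)"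
  by (rule bounded_lipschitzI[of _ _ "\<bar>c\<bar>" 0]) auto

lemma bounded_lipschitz_add:
  assumes "bounded_lipschitz X g" "bounded_lipschitz X h"
  shows "bounded_lipschitz X (\<lambda>x. g x + h x)"
proof -
  obtain B where B: "\<And>x. x \<in> X \<Longrightarrow> \<bar>g x\<bar> \<le> B"
    "\<And>x y. x \<in> X \<Longrightarrow> y \<in> X \<Longrightarrow> \<bar>g x - g y\<bar> \<le> B * seq_dist x y"
    using assms(1) by (rule bounded_lipschitzE) blast
  obtain C where C: "\<And>x. x \<in> X \<Longrightarrow> \<bar>h x\<bar> \<le> C"
    "\<And>x y. x \<in> X \<Longrightarrow> y \<in> X \<Longrightarrow> \<bar>h x - h y\<bar> \<le> C * seq_dist x y"
    using assms(2) by (rule bounded_lipschitzE) blast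
  show ?thesis
  proof (rule bounded_lipschitzI)
    fix x y assume xy: "x \<in> X" "y \<in> X"
    show "\<bar>g x + h x\<bar> \<le> B + C" using B(1)[OF xy(1)] C(1)[OF xy(1)] by linarith
    show "\<bar>g x + h x - (g y + h y)\<bar> \<le> (B + C) * seq_dist x y"
      using B(2)[OF xy] C(2)[OF xy] by (simp add: distrib_right)
  qed
qed

lemma bounded_lipschitz_mult:
  assumes "bounded_lipschitz X g" "bounded_lipschitz X h"
  shows "bounded_lipschitz X (\<lambda>x. g x * h x)"
proof -
  obtain B where B: "B > 0" "\<And>x. x \<in> X \<Longrightarrow> \<bar>g x\<bar> \<le> B"
    "\<And>x y. x \<in> X \<Longrightarrow> y \<in> X \<Longrightarrow> \<bar>g x - g y\<bar> \<le> B * seq_dist x y"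
    using assms(1) by (rule bounded_lipschitzE) blast
  obtain C where C: "C > 0" "\<And>x. x \<in> X \<Longrightarrow> \<bar>h x\<bar> \<le> C"
    "\<And>x y. x \<in> X \<Longrightarrow> y \<in> X \<Longrightarrow> \<bar>h x - h y\<bar> \<le> C * seq_dist x y"
    using assms(2) by (rule bounded_lipschitzE) blast
  show ?thesis
  proof (rule bounded_lipschitzI)
    fix x y assume xy: "x \<in> X" "y \<in> X"
    show "\<bar>g x * h x\<bar> \<le> B * C"
      unfolding abs_mult by (intro mult_mono B C xy) (use B in auto)
    have "g x * h x - g y * h y = g x * (h x - h y) + (g x - g y) * h y"
      by (simp add: algebra_simps)
    then have "\<bar>g x * h x - g y * h y\<bar> \<le> \<bar>g x\<bar> * \<bar>h x - h y\<bar> + \<bar>g x - g y\<bar> * \<bar>h y\<bar>"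
      by (metis abs_mult abs_triangle_ineq)
    also have "\<dots> \<le> B * (C * seq_dist x y) + (B * seq_dist x y) * C"
      by (intro add_mono mult_mono B C xy) (use B C seq_dist_nonneg in auto)
    finally show "\<bar>g x * h x - g y * h y\<bar> \<le> (2 * B * C) * seq_dist x y" by simp
  qed
qed

lemma abs_exp_diff_le:
  fixes s t :: real
  assumes "s \<le> B" "t \<le> B"
  shows "\<bar>exp s - exp t\<bar> \<le> exp B * \<bar>s - t\<bar>"
proof -
  have *: "exp v - exp u \<le> exp B * (v - u)" if "u \<le> v" "v \<le> B" for u v :: real
  proof -
    have "1 - exp (u - v) \<le> v - u" using exp_ge_add_one_self[of "u - v"] by linarith
    then have "exp v * (1 - exp (u - v)) \<le> exp B * (v - u)"
      using that by (intro mult_mono) auto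
    then show ?thesis by (simp add: right_diff_distrib exp_diff)
  qed
  show ?thesis using *[of s t] *[of t s] assms by (cases "s \<le> t") auto
qed

lemma bounded_lipschitz_exp:
  assumes "bounded_lipschitz X g"
  shows "bounded_lipschitz X (\<lambda>x. exp (g x))"
proof -
  obtain B where B: "\<And>x. x \<in> X \<Longrightarrow> \<bar>g x\<bar> \<le> B"
    "\<And>x y. x \<in> X \<Longrightarrow> y \<in> X \<Longrightarrow> \<bar>g x - g y\<bar> \<le> B * seq_dist x y"
    using assms by (rule bounded_lipschitzE) blast
  show ?thesis
  proof (rule bounded_lipschitzI)
    fix x y assume xy: "x \<in> X" "y \<in> X"
    show "\<bar>exp (g x)\<bar> \<le> exp B" using B(1)[OF xy(1)] by simp
    have "\<bar>exp (g x) - exp (g y)\<bar> \<le> exp B * \<bar>g x - g y\<bar>"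
      using B(1)[OF xy(1)] B(1)[OF xy(2)] by (intro abs_exp_diff_le) auto
    also have "\<dots> \<le> exp B * (B * seq_dist x y)" by (intro mult_left_mono B xy) auto
    finally show "\<bar>exp (g x) - exp (g y)\<bar> \<le> (exp B * B) * seq_dist x y" by simp
  qed
qed

lemma bounded_lipschitz_cylinder: "bounded_lipschitz X (indicator (cylinder X n z))"
proof (rule bounded_lipschitzI)
  fix x y assume "x \<in> X" "y \<in> X"
  show "\<bar>indicator (cylinder X n z) x\<bar> \<le> (1::real)" by (simp add: indicator_def)
  show "\<bar>indicator (cylinder X n z) x - indicator (cylinder X n z) y\<bar> \<le> 2 ^ Suc n * seq_dist x y"
  proof (cases "\<forall>j<n. x j = y j")
    case True
    then show ?thesis using \<open>x \<in> X\<close> \<open>y \<in> X\<close> by (auto simp: cylinder_def indicator_def seq_dist_nonneg)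
  next
    case False
    then have "2 ^ Suc n * (1/2) ^ Suc n \<le> 2 ^ Suc n * seq_dist x y"
      using seq_dist_le_iff[of x y n] by (intro mult_left_mono) auto
    then have "1 \<le> 2 ^ Suc n * seq_dist x y"
      by (simp add: power_one_over del: power_Suc)
    moreover have "\<bar>indicator (cylinder X n z) x - indicator (cylinder X n z) y\<bar> \<le> (1::real)"
      by (simp add: indicator_def)
    ultimately show ?thesis by linarith
  qed
qed

lemma bounded_lipschitz_potential:
  assumes "\<phi> \<in> normalized_potentials X"
  shows "bounded_lipschitz X \<phi>"
proof (cases "X = {}")
  case False
  then obtain z where z: "z \<in> X" by auto
  obtain B where B: "\<And>x y. x \<in> X \<Longrightarrow> y \<in> X \<Longrightarrow> \<bar>\<phi> x - \<phi> y\<bar> \<le> B * seq_dist x y"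
    using assms unfolding normalized_potentials_def Lipschitz_continuous_map_def
    by (auto simp: dist_real_def)
  show ?thesis
  proof (rule bounded_lipschitzI[OF _ B])
    fix x assume x: "x \<in> X"
    have "B * seq_dist x z \<le> \<bar>B\<bar> * 1"
      using seq_dist_le_half[of x z] by (intro mult_mono) (auto simp: seq_dist_nonneg)
    then show "\<bar>\<phi> x\<bar> \<le> \<bar>B\<bar> + \<bar>\<phi> z\<bar>" using B[OF x z] by linarith
  qed auto
qed (simp add: bounded_lipschitz_def)

text \<open>Gibbs measures are tested against continuous functions; all test functions used here are
  Lipschitz.\<close>

lemma continuous_map_bounded_lipschitz:
  assumes "bounded_lipschitz X g"
  shows "continuous_map (seq_topology X) euclideanreal g"
proof -
  obtain B where "\<And>x y. x \<in> X \<Longrightarrow> y \<in> X \<Longrightarrow> \<bar>g x - g y\<bar> \<le> B * seq_dist x y"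
    using assms by (rule bounded_lipschitzE) blast
  then have "Lipschitz_continuous_map (seq_metric X) euclidean_metric g"
    unfolding Lipschitz_continuous_map_def by (auto simp: dist_real_def)
  then show ?thesis
    unfolding seq_topology_def by (metis Lipschitz_continuous_imp_continuous_map mtopology_of_euclidean)
qed

lemma topspace_seq_topology [simp]: "topspace (seq_topology X) = X"
  unfolding seq_topology_def by simp

lemma space_seq_borel [simp]: "space (seq_borel X) = X"
  unfolding seq_borel_def by (rule space_measure_of) (use openin_subset[of "seq_topology X"] in auto)

lemma open_in_sets_seq_borel: "openin (seq_topology X) U \<Longrightarrow> U \<in> sets (seq_borel X)"
  unfolding seq_borel_def by (subst sets_measure_of) (use openin_subset[of "seq_topology X"] in auto)

lemma borel_measurable_bounded_lipschitz:
  assumes "bounded_lipschitz X g"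
  shows "g \<in> borel_measurable (seq_borel X)"
proof (rule borel_measurableI)
  fix S :: "real set" assume "open S"
  then have "openin (seq_topology X) {x \<in> topspace (seq_topology X). g x \<in> S}"
    using continuous_map_bounded_lipschitz[OF assms]
    by (intro openin_continuous_map_preimage) auto
  moreover have "{x \<in> topspace (seq_topology X). g x \<in> S} = g -` S \<inter> space (seq_borel X)"
    by auto
  ultimately show "g -` S \<inter> space (seq_borel X) \<in> sets (seq_borel X)"
    by (metis open_in_sets_seq_borel)
qed

lemma openin_cylinder: "openin (seq_topology X) (cylinder X n z)"
proof -
  interpret Metric_space X seq_dist by (rule Metric_space_seq_dist)
  have "openin mtopology (cylinder X n z)"
    unfolding openin_mtopology
  proof (intro conjI allI impI)
    fix x assume x: "x \<in> cylinder X n z"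
    have "mball x ((1/2) ^ Suc n) \<subseteq> cylinder X n z"
    proof
      fix y assume "y \<in> mball x ((1/2) ^ Suc n)"
      then have "seq_dist x y \<le> (1/2) ^ Suc n" "y \<in> X" by (auto simp: mball_def)
      then show "y \<in> cylinder X n z" using x unfolding seq_dist_le_iff cylinder_def by auto
    qed
    then show "\<exists>r>0. mball x r \<subseteq> cylinder X n z" by (intro exI[of _ "(1/2) ^ Suc n"]) simp
  qed (auto simp: cylinder_def)
  then show ?thesis by (simp add: seq_topology_def mtopology_of_def)
qed

section \<open>Iterates of the transfer operator\<close>

definition birkhoff_sum :: "((nat \<Rightarrow> nat) \<Rightarrow> real) \<Rightarrow> nat \<Rightarrow> (nat \<Rightarrow> nat) \<Rightarrow> real" where
  "birkhoff_sum \<phi> n x = (\<Sum>j<n. \<phi> ((shift ^^ j) x))"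

lemma birkhoff_sum_0 [simp]: "birkhoff_sum \<phi> 0 x = 0"
  by (simp add: birkhoff_sum_def)

lemma birkhoff_sum_Suc: "birkhoff_sum \<phi> (Suc n) x = \<phi> x + birkhoff_sum \<phi> n (shift x)"
  unfolding birkhoff_sum_def by (subst sum.lessThan_Suc_shift) (simp add: funpow_swap1)

locale subshift =
  fixes q :: nat and A :: "nat \<Rightarrow> nat \<Rightarrow> nat" and X :: "(nat \<Rightarrow> nat) set"
  assumes X_eq: "X = sft q A"
begin

lemma shift_in: "x \<in> X \<Longrightarrow> shift x \<in> X"
  by (auto simp: X_eq sft_def shift_def)

lemma shift_funpow_in: "x \<in> X \<Longrightarrow> (shift ^^ n) x \<in> X"
  by (induction n) (auto intro: shift_in)

lemma symbol_in: "x \<in> X \<Longrightarrow> x j \<in> {1..q}"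
  by (auto simp: X_eq sft_def)

text \<open>The Markov property of a subshift of finite type: a word may be followed by any point that starts
  with the symbol that the word allows.\<close>

lemma glue_in:
  assumes x: "x \<in> X" and y: "y \<in> X" and "x n = y 0"
  shows "(\<lambda>j. if j < n then x j else y (j - n)) \<in> X" (is "?w \<in> X")
  unfolding X_eq sft_def
proof (intro CollectI allI conjI)
  fix j
  show "?w j \<in> {1..q}" using symbol_in[OF x] symbol_in[OF y] by auto
  have adj: "A (x j) (x (Suc j)) = 1" "A (y (j - n)) (y (Suc (j - n))) = 1"
    using x y by (auto simp: X_eq sft_def)
  consider "Suc j < n" | "Suc j = n" | "n \<le> j" by linarith
  then show "A (?w j) (?w (Suc j)) = 1"
    by cases (use adj assms(3) in \<open>auto simp: Suc_diff_le\<close>)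
qed

lemma preimages_eq:
  assumes "x \<in> X"
  shows "{y \<in> X. shift y = x} = (\<lambda>i. case_nat i x) ` {i \<in> {1..q}. A i (x 0) = 1}"
proof (intro equalityI subsetI)
  fix y assume y: "y \<in> {y \<in> X. shift y = x}"
  then have "y = case_nat (y 0) x" using case_nat_shift[of y] by simp
  moreover have "y 0 \<in> {1..q}" "A (y 0) (y 1) = 1" using y by (auto simp: X_eq sft_def)
  moreover have "y 1 = x 0" using y by (auto simp: shift_def)
  ultimately show "y \<in> (\<lambda>i. case_nat i x) ` {i \<in> {1..q}. A i (x 0) = 1}" by auto
next
  fix y assume "y \<in> (\<lambda>i. case_nat i x) ` {i \<in> {1..q}. A i (x 0) = 1}"
  then show "y \<in> {y \<in> X. shift y = x}"
    using assms by (auto simp: X_eq sft_def shift_def split: nat.split)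
qed

lemma finite_preimages: "finite {y \<in> X. shift y = x}"
  using finite_preimages_sft[of q A x] by (simp add: X_eq)

text \<open>Indexing the preimages of \<open>x\<close> by their first symbol makes two points with the same first symbol
  sum over the same index set, so that the sums can be compared term by term.\<close>

lemma transfer_op_symbols:
  assumes "x \<in> X"
  shows "transfer_op X \<phi> g x =
    (\<Sum>i | i \<in> {1..q} \<and> A i (x 0) = 1. exp (\<phi> (case_nat i x)) * g (case_nat i x))"
proof -
  have inj: "inj_on (\<lambda>i. case_nat i x) S" for S
    by (rule inj_onI) (auto dest: fun_cong[of _ _ 0])
  show ?thesis
    unfolding transfer_op_def preimages_eq[OF assms] by (subst sum.reindex[OF inj]) simp
qed

lemma case_nat_in:
  "x \<in> X \<Longrightarrow> i \<in> {1..q} \<Longrightarrow> A i (x 0) = 1 \<Longrightarrow> case_nat i x \<in> X"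
  using preimages_eq[of x] by blast

lemma finite_preimages_funpow: "finite {w \<in> X. (shift ^^ n) w = x}"
proof (induction n arbitrary: x)
  case (Suc n)
  have "{w \<in> X. (shift ^^ Suc n) w = x} \<subseteq> (\<Union>v \<in> {v \<in> X. (shift ^^ n) v = x}. {w \<in> X. shift w = v})"
    using shift_in by (auto simp: funpow_swap1)
  then show ?case by (rule finite_subset) (use Suc finite_preimages in auto)
qed auto

lemma transfer_op_funpow:
  "(transfer_op X \<phi> ^^ n) g x =
     (\<Sum>w | w \<in> X \<and> (shift ^^ n) w = x. exp (birkhoff_sum \<phi> n w) * g w)" if "x \<in> X"
  using that
proof (induction n arbitrary: g)
  case 0
  then have "{w. w \<in> X \<and> w = x} = {x}" by auto
  then show ?case by simp
next
  case (Suc n)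
  have "(transfer_op X \<phi> ^^ Suc n) g x = (transfer_op X \<phi> ^^ n) (transfer_op X \<phi> g) x"
    by (simp add: funpow_swap1)
  also have "\<dots> = (\<Sum>v | v \<in> X \<and> (shift ^^ n) v = x. \<Sum>w | w \<in> X \<and> shift w = v.
      exp (birkhoff_sum \<phi> (Suc n) w) * g w)"
    unfolding Suc.IH[OF Suc.prems]
    by (intro sum.cong refl)
      (auto simp: transfer_op_def sum_distrib_left birkhoff_sum_Suc exp_add mult_ac intro!: sum.cong)
  also have "\<dots> = (\<Sum>v | v \<in> X \<and> (shift ^^ n) v = x.
      \<Sum>w | w \<in> {w. w \<in> X \<and> (shift ^^ Suc n) w = x} \<and> shift w = v.
      exp (birkhoff_sum \<phi> (Suc n) w) * g w)"
    by (intro sum.cong refl) (auto simp: funpow_swap1)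
  also have "\<dots> = (\<Sum>w | w \<in> X \<and> (shift ^^ Suc n) w = x. exp (birkhoff_sum \<phi> (Suc n) w) * g w)"
    by (rule sum.group) (use finite_preimages_funpow[of n] finite_preimages_funpow[of "Suc n"] shift_in
      in \<open>auto simp: funpow_swap1\<close>)
  finally show ?case .
qed

lemma bounded_lipschitz_shift:
  assumes "bounded_lipschitz X g"
  shows "bounded_lipschitz X (\<lambda>x. g (shift x))"
proof -
  obtain B where B: "B > 0" "\<And>x. x \<in> X \<Longrightarrow> \<bar>g x\<bar> \<le> B"
    "\<And>x y. x \<in> X \<Longrightarrow> y \<in> X \<Longrightarrow> \<bar>g x - g y\<bar> \<le> B * seq_dist x y"
    using assms by (rule bounded_lipschitzE) blast
  show ?thesis
  proof (rule bounded_lipschitzI)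
    fix x y assume xy: "x \<in> X" "y \<in> X"
    show "\<bar>g (shift x)\<bar> \<le> B" by (intro B shift_in xy)
    have "\<bar>g (shift x) - g (shift y)\<bar> \<le> B * seq_dist (shift x) (shift y)"
      by (intro B shift_in xy)
    also have "\<dots> \<le> B * (2 * seq_dist x y)" by (intro mult_left_mono seq_dist_shift) (use B in auto)
    finally show "\<bar>g (shift x) - g (shift y)\<bar> \<le> (B * 2) * seq_dist x y" by simp
  qed
qed

lemma bounded_lipschitz_birkhoff_sum:
  assumes "bounded_lipschitz X \<phi>"
  shows "bounded_lipschitz X (birkhoff_sum \<phi> n)"
proof (induction n)
  case 0
  show ?case using bounded_lipschitz_const[of X 0] by (simp add: birkhoff_sum_def)
next
  case (Suc n)
  show ?case
    unfolding birkhoff_sum_Suc[abs_def]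
    by (intro bounded_lipschitz_add bounded_lipschitz_shift Suc assms)
qed

lemma bounded_lipschitz_transfer_op:
  assumes "bounded_lipschitz X \<phi>" "bounded_lipschitz X g"
  shows "bounded_lipschitz X (transfer_op X \<phi> g)"
proof -
  have "bounded_lipschitz X (\<lambda>x. exp (\<phi> x) * g x)" (is "bounded_lipschitz X ?h")
    by (intro bounded_lipschitz_mult bounded_lipschitz_exp assms)
  then obtain B where B: "B > 0" "\<And>x. x \<in> X \<Longrightarrow> \<bar>?h x\<bar> \<le> B"
    "\<And>x y. x \<in> X \<Longrightarrow> y \<in> X \<Longrightarrow> \<bar>?h x - ?h y\<bar> \<le> B * seq_dist x y"
    by (rule bounded_lipschitzE) blast
  define I where "I = (\<lambda>s. {i. i \<in> {1..q} \<and> A i s = 1})"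
  have I: "transfer_op X \<phi> g x = (\<Sum>i\<in>I (x 0). ?h (case_nat i x))" if "x \<in> X" for x
    unfolding I_def using transfer_op_symbols[OF that] by simp
  have cardI: "real (card (I s)) \<le> real q" for s
    using card_mono[of "{1..q}" "I s"] unfolding I_def by fastforce
  show ?thesis
  proof (rule bounded_lipschitzI_same_symbol)
    fix x assume x: "x \<in> X"
    have "\<bar>transfer_op X \<phi> g x\<bar> \<le> (\<Sum>i\<in>I (x 0). \<bar>?h (case_nat i x)\<bar>)"
      unfolding I[OF x] by (rule sum_abs)
    also have "\<dots> \<le> (\<Sum>i\<in>I (x 0). B)"
      by (intro sum_mono B case_nat_in x) (auto simp: I_def)
    also have "\<dots> \<le> q * B" using cardI B(1) by (simp add: mult_right_mono)
    finally show "\<bar>transfer_op X \<phi> g x\<bar> \<le> q * B" .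
    fix y assume y: "y \<in> X" and xy: "x 0 = y 0"
    have "\<bar>transfer_op X \<phi> g x - transfer_op X \<phi> g y\<bar>
        \<le> (\<Sum>i\<in>I (x 0). \<bar>?h (case_nat i x) - ?h (case_nat i y)\<bar>)"
      unfolding I[OF x] I[OF y] xy sum_subtractf[symmetric] by (rule sum_abs)
    also have "\<dots> \<le> (\<Sum>i\<in>I (x 0). B * seq_dist x y)"
    proof (rule sum_mono)
      fix i assume i: "i \<in> I (x 0)"
      have "\<bar>?h (case_nat i x) - ?h (case_nat i y)\<bar> \<le> B * seq_dist (case_nat i x) (case_nat i y)"
        using i xy by (intro B case_nat_in x y) (auto simp: I_def)
      also have "\<dots> \<le> B * seq_dist x y"
        using seq_dist_case_nat[of i x y] seq_dist_nonneg[of x y] B(1) by (intro mult_left_mono) auto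
      finally show "\<bar>?h (case_nat i x) - ?h (case_nat i y)\<bar> \<le> B * seq_dist x y" .
    qed
    also have "\<dots> \<le> (q * B) * seq_dist x y"
      using mult_right_mono[OF cardI, of "B * seq_dist x y" "x 0"] B(1) seq_dist_nonneg[of x y]
      by (simp add: mult.assoc)
    finally show "\<bar>transfer_op X \<phi> g x - transfer_op X \<phi> g y\<bar> \<le> (q * B) * seq_dist x y" .
  qed (use B in auto)
qed

lemma bounded_lipschitz_transfer_op_funpow:
  assumes "bounded_lipschitz X \<phi>" "bounded_lipschitz X g"
  shows "bounded_lipschitz X ((transfer_op X \<phi> ^^ n) g)"
  by (induction n) (auto intro: assms bounded_lipschitz_transfer_op)

lemma transfer_op_mono:
  assumes "\<And>x. x \<in> X \<Longrightarrow> g x \<le> h x"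
  shows "transfer_op X \<phi> g x \<le> transfer_op X \<phi> h x"
  unfolding transfer_op_def by (intro sum_mono mult_left_mono) (use assms in auto)

lemma transfer_op_scale: "transfer_op X \<phi> (\<lambda>x. c * g x) x = c * transfer_op X \<phi> g x"
  unfolding transfer_op_def by (simp add: sum_distrib_left mult_ac)

text \<open>Bounded distortion: the \<open>j\<close>-th shifts of two points that share their first \<open>n\<close> symbols are at distance
  at most \<open>(1/2)\<^bsup>n - j + 1\<^esup>\<close>, and these distances form a geometric series.\<close>

lemma birkhoff_sum_distortion:
  assumes B: "\<And>x y. x \<in> X \<Longrightarrow> y \<in> X \<Longrightarrow> \<bar>\<phi> x - \<phi> y\<bar> \<le> B * seq_dist x y" "B \<ge> 0"
    and xy: "x \<in> X" "y \<in> X" "\<forall>j<n. x j = y j"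
  shows "\<bar>birkhoff_sum \<phi> n x - birkhoff_sum \<phi> n y\<bar> \<le> B"
proof -
  have "\<bar>birkhoff_sum \<phi> n x - birkhoff_sum \<phi> n y\<bar> \<le> B * (1 - (1/2) ^ n)"
    using xy
  proof (induction n arbitrary: x y)
    case (Suc n)
    have "\<bar>\<phi> x - \<phi> y\<bar> \<le> B * seq_dist x y" using B Suc.prems by blast
    also have "\<dots> \<le> B * (1/2) ^ Suc (Suc n)"
      using Suc.prems seq_dist_le_iff[of x y "Suc n"] B(2) by (intro mult_left_mono) auto
    also have "\<dots> \<le> B * (1/2) ^ Suc n" using B(2) by (intro mult_left_mono) auto
    finally have 1: "\<bar>\<phi> x - \<phi> y\<bar> \<le> B * (1/2) ^ Suc n" .
    have 2: "\<bar>birkhoff_sum \<phi> n (shift x) - birkhoff_sum \<phi> n (shift y)\<bar> \<le> B * (1 - (1/2) ^ n)"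
      using Suc.prems by (intro Suc.IH shift_in) (auto simp: shift_def)
    have "B * (1 - (1/2) ^ Suc n) = B * (1/2) ^ Suc n + B * (1 - (1/2) ^ n)"
      by (simp add: algebra_simps)
    then show ?case using 1 2 unfolding birkhoff_sum_Suc by linarith
  qed simp
  also have "\<dots> \<le> B * 1" using B(2) by (intro mult_left_mono) auto
  finally show ?thesis by simp
qed

lemma birkhoff_sum_diff_le:
  assumes "\<And>x. x \<in> X \<Longrightarrow> \<bar>\<phi> x - \<psi> x\<bar> \<le> \<eta>" "x \<in> X"
  shows "\<bar>birkhoff_sum \<phi> n x - birkhoff_sum \<psi> n x\<bar> \<le> n * \<eta>"
  using assms(2)
proof (induction n arbitrary: x)
  case (Suc n)
  show ?case using assms(1)[OF Suc.prems] Suc.IH[OF shift_in[OF Suc.prems]]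
    unfolding birkhoff_sum_Suc by (simp add: distrib_right)
qed simp

lemma birkhoff_sum_abs_le:
  assumes "\<And>x. x \<in> X \<Longrightarrow> \<bar>\<phi> x\<bar> \<le> B" "x \<in> X"
  shows "\<bar>birkhoff_sum \<phi> n x\<bar> \<le> n * B"
  using birkhoff_sum_diff_le[of \<phi> "\<lambda>_. 0" B x n] assms by (simp add: birkhoff_sum_def)

end

section \<open>Transitivity\<close>

locale transitive_subshift = subshift +
  assumes transitive: "topologically_transitive X"
begin

lemma symbol_path:
  assumes "x \<in> X" "z \<in> X"
  shows "\<exists>n. \<exists>u\<in>X. u 0 = z 0 \<and> u n = x 0"
proof -
  have "z \<in> cylinder X 1 z" "x \<in> cylinder X 1 x" using assms by (auto simp: cylinder_def)
  then have "cylinder X 1 z \<noteq> {}" "cylinder X 1 x \<noteq> {}" by blast+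
  then obtain n where "(shift ^^ n) ` cylinder X 1 z \<inter> cylinder X 1 x \<noteq> {}"
    using transitive[unfolded topologically_transitive_def, rule_format, of "cylinder X 1 z" "cylinder X 1 x"]
      openin_cylinder by metis
  then obtain u where "u \<in> cylinder X 1 z" "(shift ^^ n) u \<in> cylinder X 1 x" by blast
  then have "u \<in> X" "u 0 = z 0" "u n = x 0" by (simp_all add: cylinder_def shift_funpow)
  then show ?thesis by blast
qed

text \<open>There are finitely many pairs of symbols, hence a common bound on the connecting times.\<close>

lemma symbol_path_bounded:
  "\<exists>N. \<forall>x\<in>X. \<forall>z\<in>X. \<exists>n\<le>N. \<exists>u\<in>X. u 0 = z 0 \<and> u n = x 0"
proof -
  define S where "S = (\<lambda>x. x 0) ` X"
  have "S \<subseteq> {1..q}" unfolding S_def by (intro image_subsetI symbol_in)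
  then have "finite S" using finite_subset by blast
  then have fin: "finite (S \<times> S)" by simp
  have "\<forall>p\<in>S \<times> S. \<exists>n. \<exists>u\<in>X. u 0 = snd p \<and> u n = fst p"
  proof
    fix p assume "p \<in> S \<times> S"
    then obtain x z where "x \<in> X" "z \<in> X" "p = (x 0, z 0)" by (auto simp: S_def)
    then show "\<exists>n. \<exists>u\<in>X. u 0 = snd p \<and> u n = fst p" using symbol_path[of x z] by simp
  qed
  from bchoice[OF this] obtain k where k: "\<forall>p\<in>S \<times> S. \<exists>u\<in>X. u 0 = snd p \<and> u (k p) = fst p" ..
  show ?thesis
  proof (rule exI[of _ "Max (k ` (S \<times> S))"], intro ballI)
    fix x z assume "x \<in> X" "z \<in> X"
    then have p: "(x 0, z 0) \<in> S \<times> S" by (auto simp: S_def)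
    then have "k (x 0, z 0) \<le> Max (k ` (S \<times> S))" using fin by (intro Max_ge) auto
    moreover have "\<exists>u\<in>X. u 0 = z 0 \<and> u (k (x 0, z 0)) = x 0" using k[rule_format, OF p] by simp
    ultimately show "\<exists>n\<le>Max (k ` (S \<times> S)). \<exists>u\<in>X. u 0 = z 0 \<and> u n = x 0" by blast
  qed
qed

text \<open>The form in which transitivity is used: every \<open>m\<close>-cylinder contains a preimage of every point, of an
  order bounded uniformly in both. The preimage follows \<open>z\<close> for \<open>m\<close> symbols, then a path from \<open>z m\<close> to
  the first symbol of \<open>x\<close>, then \<open>x\<close>.\<close>

lemma backward_orbits_dense:
  "\<exists>M. \<forall>x\<in>X. \<forall>z\<in>X. \<exists>k\<le>M. \<exists>w\<in>X. (shift ^^ k) w = x \<and> (\<forall>j<m. w j = z j)"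
proof -
  obtain N where N: "\<forall>x\<in>X. \<forall>z\<in>X. \<exists>n\<le>N. \<exists>u\<in>X. u 0 = z 0 \<and> u n = x 0"
    using symbol_path_bounded by blast
  show ?thesis
  proof (rule exI[of _ "m + N"], intro ballI)
    fix x z assume x: "x \<in> X" and z: "z \<in> X"
    obtain n u where n: "n \<le> N" and u: "u \<in> X" "u 0 = z m" "u n = x 0"
      using N[rule_format, OF x shift_funpow_in[OF z, of m]] by (auto simp: shift_funpow)
    define v where "v = (\<lambda>j. if j < n then u j else x (j - n))"
    have v: "v \<in> X" unfolding v_def by (rule glue_in) (use u x in auto)
    have v0: "v 0 = z m" using u by (auto simp: v_def)
    define w where "w = (\<lambda>j. if j < m then z j else v (j - m))"
    have w: "w \<in> X" unfolding w_def by (rule glue_in) (use z v v0 in auto)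
    show "\<exists>k\<le>m + N. \<exists>w\<in>X. (shift ^^ k) w = x \<and> (\<forall>j<m. w j = z j)"
    proof (intro exI[of _ "m + n"] conjI bexI[of _ w] w)
      show "m + n \<le> m + N" using n by simp
      show "(shift ^^ (m + n)) w = x" unfolding shift_funpow by (auto simp: w_def v_def)
      show "\<forall>j<m. w j = z j" by (auto simp: w_def)
    qed
  qed
qed

text \<open>A single preimage of order at most \<open>M\<close> carries a weight bounded below in terms of \<open>M\<close> and the sup
  norm of the potential.\<close>

lemma transfer_op_funpow_ge:
  assumes "x \<in> X" "w \<in> X" "(shift ^^ k) w = x" "k \<le> M"
    and "\<And>x. x \<in> X \<Longrightarrow> \<bar>\<phi> x\<bar> \<le> B" "\<And>x. x \<in> X \<Longrightarrow> 0 \<le> g x"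
  shows "exp (- (M * B)) * g w \<le> (transfer_op X \<phi> ^^ k) g x"
proof -
  have "0 \<le> B" using assms(5)[OF assms(1)] by linarith
  then have "k * B \<le> M * B" using assms(4) by (intro mult_right_mono) auto
  then have "exp (- (M * B)) * g w \<le> exp (birkhoff_sum \<phi> k w) * g w"
    using birkhoff_sum_abs_le[of \<phi> B w k] assms by (intro mult_right_mono) auto
  also have "\<dots> \<le> (transfer_op X \<phi> ^^ k) g x"
    unfolding transfer_op_funpow[OF assms(1)]
    by (rule member_le_sum) (use assms finite_preimages_funpow in auto)
  finally show ?thesis .
qed

section \<open>Gibbs measures\<close>

lemma gibbs_measure_props:
  assumes "gibbs_measure X \<phi> m"
  shows "prob_space m" "space m = X" "sets m = sets (seq_borel X)"
  using assms sets_eq_imp_space_eq[of m "seq_borel X"] by (auto simp: gibbs_measure_def)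

lemma integrable_gibbs:
  assumes "gibbs_measure X \<phi> m" "bounded_lipschitz X g"
  shows "integrable m g"
proof -
  interpret prob_space m using assms(1) by (rule gibbs_measure_props)
  have "g \<in> borel_measurable m"
    using borel_measurable_bounded_lipschitz[OF assms(2)] gibbs_measure_props(3)[OF assms(1)]
    by (simp cong: measurable_cong_sets)
  moreover obtain B where "\<And>x. x \<in> X \<Longrightarrow> \<bar>g x\<bar> \<le> B"
    using assms(2) by (rule bounded_lipschitzE) blast
  ultimately show ?thesis
    using gibbs_measure_props(2)[OF assms(1)] by (intro integrable_const_bound[of _ B]) auto
qed

lemma integral_transfer_op:
  assumes "gibbs_measure X \<phi> m" "bounded_lipschitz X g"
  shows "(\<integral>x. transfer_op X \<phi> g x \<partial>m) = (\<integral>x. g x \<partial>m)"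
  using assms continuous_map_bounded_lipschitz unfolding gibbs_measure_def by blast

lemma integral_transfer_op_funpow:
  assumes "gibbs_measure X \<phi> m" "bounded_lipschitz X \<phi>" "bounded_lipschitz X g"
  shows "(\<integral>x. (transfer_op X \<phi> ^^ n) g x \<partial>m) = (\<integral>x. g x \<partial>m)"
  by (induction n) (simp_all add: integral_transfer_op assms bounded_lipschitz_transfer_op_funpow)

lemma measure_cylinder_eq_integral:
  assumes "gibbs_measure X \<phi> m"
  shows "measure m (cylinder X n y) = (\<integral>x. indicator (cylinder X n y) x \<partial>m)"
proof -
  have "cylinder X n y \<inter> space m = cylinder X n y"
    using gibbs_measure_props(2)[OF assms] by (auto simp: cylinder_def)
  then show ?thesis by simp
qed

text \<open>An \<open>n\<close>-cylinder contains at most one \<open>n\<close>-th preimage of a point, the concatenation of the defining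
  word and the point.\<close>

lemma transfer_op_funpow_cylinder:
  assumes "x \<in> X"
  shows "(transfer_op X \<phi> ^^ n) (indicator (cylinder X n y)) x =
    (let w = (\<lambda>j. if j < n then y j else x (j - n))
     in if w \<in> X then exp (birkhoff_sum \<phi> n w) else 0)"
proof -
  define w where "w = (\<lambda>j. if j < n then y j else x (j - n))"
  have w: "v = w" if "(shift ^^ n) v = x" "v \<in> cylinder X n y" for v
  proof
    fix j show "v j = w j"
      using that(2) fun_cong[OF that(1), of "j - n"] by (auto simp: w_def cylinder_def shift_funpow)
  qed
  have "(transfer_op X \<phi> ^^ n) (indicator (cylinder X n y)) x =
    (\<Sum>v\<in>{v \<in> X. (shift ^^ n) v = x} \<inter> cylinder X n y. exp (birkhoff_sum \<phi> n v))"
    unfolding transfer_op_funpow[OF assms]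
    by (rule sum.mono_neutral_cong_right) (use finite_preimages_funpow in \<open>auto simp: indicator_def\<close>)
  also have "{v \<in> X. (shift ^^ n) v = x} \<inter> cylinder X n y = (if w \<in> X then {w} else {})"
    using w by (auto simp: w_def cylinder_def shift_funpow)
  finally show ?thesis by (simp add: w_def Let_def)
qed

text \<open>The upper half of the Gibbs property, stated for a reference potential \<open>\<psi>\<close> near \<open>\<phi>\<close>: the distortion
  constant is then that of \<open>\<psi>\<close>, so the estimate is uniform over all \<open>\<phi>\<close> in a sup-norm ball.\<close>

lemma measure_cylinder_le:
  assumes m: "gibbs_measure X \<phi> m" "bounded_lipschitz X \<phi>"
    and close: "\<And>x. x \<in> X \<Longrightarrow> \<bar>\<phi> x - \<psi> x\<bar> \<le> \<eta>"
    and B: "\<And>x y. x \<in> X \<Longrightarrow> y \<in> X \<Longrightarrow> \<bar>\<psi> x - \<psi> y\<bar> \<le> B * seq_dist x y" "B \<ge> 0"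
    and y: "y \<in> X"
  shows "measure m (cylinder X n y) \<le> exp (birkhoff_sum \<psi> n y + B + n * \<eta>)"
proof -
  interpret prob_space m using m(1) by (rule gibbs_measure_props)
  let ?C = "indicator (cylinder X n y) :: _ \<Rightarrow> real"
  have "(transfer_op X \<phi> ^^ n) ?C x \<le> exp (birkhoff_sum \<psi> n y + B + n * \<eta>)" if x: "x \<in> X" for x
  proof -
    define w where "w = (\<lambda>j. if j < n then y j else x (j - n))"
    have "birkhoff_sum \<phi> n w \<le> birkhoff_sum \<psi> n y + B + n * \<eta>" if "w \<in> X"
    proof -
      have "\<bar>birkhoff_sum \<phi> n w - birkhoff_sum \<psi> n w\<bar> \<le> n * \<eta>"
        using birkhoff_sum_diff_le[OF close that] .
      moreover have "\<bar>birkhoff_sum \<psi> n w - birkhoff_sum \<psi> n y\<bar> \<le> B"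
        by (rule birkhoff_sum_distortion[OF B that y]) (simp_all add: w_def)
      ultimately show ?thesis by linarith
    qed
    then show ?thesis unfolding transfer_op_funpow_cylinder[OF x] w_def[symmetric] by simp
  qed
  then have "(\<integral>x. (transfer_op X \<phi> ^^ n) ?C x \<partial>m) \<le> exp (birkhoff_sum \<psi> n y + B + n * \<eta>)"
    using gibbs_measure_props(2)[OF m(1)]
    by (intro integral_le_const integrable_gibbs[OF m(1)] bounded_lipschitz_transfer_op_funpow m
        bounded_lipschitz_cylinder) auto
  then show ?thesis
    unfolding measure_cylinder_eq_integral[OF m(1)]
    by (simp only: integral_transfer_op_funpow[OF m bounded_lipschitz_cylinder])
qed

text \<open>The lower half of the Gibbs property. The word of \<open>y\<close> can be followed by every point of the
  1-cylinder of \<open>(shift ^^ n) y\<close>, which accounts for the extra factor.\<close>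

lemma measure_cylinder_ge:
  assumes m: "gibbs_measure X \<phi> m" "bounded_lipschitz X \<phi>"
    and close: "\<And>x. x \<in> X \<Longrightarrow> \<bar>\<phi> x - \<psi> x\<bar> \<le> \<eta>"
    and B: "\<And>x y. x \<in> X \<Longrightarrow> y \<in> X \<Longrightarrow> \<bar>\<psi> x - \<psi> y\<bar> \<le> B * seq_dist x y" "B \<ge> 0"
    and y: "y \<in> X"
  shows "exp (birkhoff_sum \<psi> n y - B - n * \<eta>) * measure m (cylinder X 1 ((shift ^^ n) y))
    \<le> measure m (cylinder X n y)"
proof -
  let ?C = "indicator (cylinder X n y) :: _ \<Rightarrow> real"
  let ?D = "indicator (cylinder X 1 ((shift ^^ n) y)) :: _ \<Rightarrow> real"
  let ?K = "exp (birkhoff_sum \<psi> n y - B - n * \<eta>)"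
  have le: "?K * ?D x \<le> (transfer_op X \<phi> ^^ n) ?C x" if x: "x \<in> X" for x
  proof (cases "x \<in> cylinder X 1 ((shift ^^ n) y)")
    case True
    then have x0: "y n = x 0" by (simp add: cylinder_def shift_funpow)
    define w where "w = (\<lambda>j. if j < n then y j else x (j - n))"
    have w: "w \<in> X" unfolding w_def by (rule glue_in) (use x y x0 in auto)
    have "\<bar>birkhoff_sum \<phi> n w - birkhoff_sum \<psi> n w\<bar> \<le> n * \<eta>"
      using birkhoff_sum_diff_le[OF close w] .
    moreover have "\<bar>birkhoff_sum \<psi> n w - birkhoff_sum \<psi> n y\<bar> \<le> B"
      by (rule birkhoff_sum_distortion[OF B w y]) (simp_all add: w_def)
    ultimately have "birkhoff_sum \<psi> n y - B - n * \<eta> \<le> birkhoff_sum \<phi> n w" by linarith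
    then show ?thesis
      using w unfolding transfer_op_funpow_cylinder[OF x] w_def[symmetric] by (simp add: indicator_def)
  next
    case False
    then show ?thesis unfolding transfer_op_funpow_cylinder[OF x] by (simp add: Let_def)
  qed
  have "?K * measure m (cylinder X 1 ((shift ^^ n) y)) = (\<integral>x. ?K * ?D x \<partial>m)"
    unfolding measure_cylinder_eq_integral[OF m(1)] by (rule integral_mult_right_zero[symmetric])
  also have "\<dots> \<le> (\<integral>x. (transfer_op X \<phi> ^^ n) ?C x \<partial>m)"
    using gibbs_measure_props(2)[OF m(1)] le
    by (intro integral_mono integrable_gibbs[OF m(1)] bounded_lipschitz_transfer_op_funpow m
        bounded_lipschitz_cylinder bounded_lipschitz_mult bounded_lipschitz_const) auto
  also have "\<dots> = measure m (cylinder X n y)"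
    unfolding measure_cylinder_eq_integral[OF m(1)]
    by (rule integral_transfer_op_funpow[OF m bounded_lipschitz_cylinder])
  finally show ?thesis .
qed

text \<open>Averaging the first \<open>M + 1\<close> iterates of the indicator of a 1-cylinder gives a function with a
  positive lower bound and the same integral. The bound depends on the potential only through its
  sup norm, so it is uniform over nearby parameters.\<close>

lemma symbol_measure_ge:
  "\<exists>M::nat. \<forall>\<phi> m z (B::real). gibbs_measure X \<phi> m \<longrightarrow> bounded_lipschitz X \<phi> \<longrightarrow> (\<forall>x\<in>X. \<bar>\<phi> x\<bar> \<le> B) \<longrightarrow> z \<in> X \<longrightarrow>
     exp (- (real M * B)) / (real M + 1) \<le> measure m (cylinder X 1 z)"
proof -
  obtain M where M: "\<forall>x\<in>X. \<forall>z\<in>X. \<exists>k\<le>M. \<exists>w\<in>X. (shift ^^ k) w = x \<and> (\<forall>j<1. w j = z j)"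
    using backward_orbits_dense by blast
  show ?thesis
  proof (rule exI[of _ M], intro allI impI)
    fix \<phi> m z B
    assume m: "gibbs_measure X \<phi> m" "bounded_lipschitz X \<phi>" and B: "\<forall>x\<in>X. \<bar>\<phi> x\<bar> \<le> B" and z: "z \<in> X"
    interpret prob_space m using m(1) by (rule gibbs_measure_props)
    let ?g = "indicator (cylinder X 1 z) :: _ \<Rightarrow> real"
    have le: "exp (- (M * B)) \<le> (\<Sum>k\<le>M. (transfer_op X \<phi> ^^ k) ?g x)" if x: "x \<in> X" for x
    proof -
      obtain k w where k: "k \<le> M" "w \<in> X" "(shift ^^ k) w = x" "\<forall>j<1. w j = z j"
        using M x z by blast
      then have "?g w = 1" by (simp add: cylinder_def indicator_def)
      then have "exp (- (M * B)) \<le> (transfer_op X \<phi> ^^ k) ?g x"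
        using transfer_op_funpow_ge[of x w k M \<phi> B ?g] x k B by (auto simp: indicator_def)
      also have "\<dots> \<le> (\<Sum>k\<le>M. (transfer_op X \<phi> ^^ k) ?g x)"
        using k(1) by (intro member_le_sum) (auto simp: transfer_op_funpow[OF x] intro!: sum_nonneg)
      finally show ?thesis .
    qed
    have int: "integrable m (\<lambda>x. (transfer_op X \<phi> ^^ k) ?g x)" for k
      by (intro integrable_gibbs[OF m(1)] bounded_lipschitz_transfer_op_funpow m bounded_lipschitz_cylinder)
    have "exp (- (M * B)) \<le> (\<integral>x. (\<Sum>k\<le>M. (transfer_op X \<phi> ^^ k) ?g x) \<partial>m)"
      using gibbs_measure_props(2)[OF m(1)] le int by (intro integral_ge_const) auto
    also have "\<dots> = (\<Sum>k\<le>M. measure m (cylinder X 1 z))"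
      unfolding Bochner_Integration.integral_sum[OF int] measure_cylinder_eq_integral[OF m(1)]
      by (intro sum.cong refl integral_transfer_op_funpow[OF m bounded_lipschitz_cylinder])
    finally show "exp (- (real M * B)) / (real M + 1) \<le> measure m (cylinder X 1 z)"
      by (simp add: field_simps)
  qed
qed

section \<open>Exponential decay of the Hellinger affinity\<close>

lemma transfer_op_one:
  assumes "\<phi> \<in> normalized_potentials X" "x \<in> X"
  shows "transfer_op X \<phi> (\<lambda>_. 1) x = 1"
  using assms by (simp add: normalized_potentials_def transfer_op_def)

text \<open>Expanding \<open>(exp (\<phi>/2) - exp (\<xi>/2))\<^sup>2\<close> and summing over the preimages, where both
  \<open>exp \<phi>\<close> and \<open>exp \<xi>\<close> have sum 1, shows that the deficit \<open>1 - L\<^sub>\<psi> 1\<close> is half the sum of these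
  squares.\<close>

lemma transfer_op_average_le_one:
  assumes "\<phi> \<in> normalized_potentials X" "\<xi> \<in> normalized_potentials X" "x \<in> X"
  shows "transfer_op X (\<lambda>x. (\<phi> x + \<xi> x) / 2) (\<lambda>_. 1) x \<le> 1"
    and "y \<in> X \<Longrightarrow> shift y = x \<Longrightarrow> \<phi> y \<noteq> \<xi> y \<Longrightarrow>
      transfer_op X (\<lambda>x. (\<phi> x + \<xi> x) / 2) (\<lambda>_. 1) x < 1"
proof -
  let ?P = "{y. y \<in> X \<and> shift y = x}"
  let ?d = "\<lambda>y. (exp (\<phi> y / 2) - exp (\<xi> y / 2))\<^sup>2"
  have one: "(\<Sum>y\<in>?P. exp (\<phi> y)) = 1" "(\<Sum>y\<in>?P. exp (\<xi> y)) = 1"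
    using assms by (auto simp: normalized_potentials_def)
  have sq: "?d y = exp (\<phi> y) + exp (\<xi> y) - 2 * exp ((\<phi> y + \<xi> y) / 2)" for y
  proof -
    have "exp (\<phi> y / 2) ^ 2 = exp (\<phi> y)" "exp (\<xi> y / 2) ^ 2 = exp (\<xi> y)"
      by (simp_all add: power2_eq_square mult_exp_exp)
    moreover have "exp (\<phi> y / 2) * exp (\<xi> y / 2) = exp ((\<phi> y + \<xi> y) / 2)"
      by (simp add: mult_exp_exp add_divide_distrib)
    ultimately show ?thesis by (simp add: power2_diff)
  qed
  have "(\<Sum>y\<in>?P. ?d y) = 2 - 2 * (\<Sum>y\<in>?P. exp ((\<phi> y + \<xi> y) / 2))"
    unfolding sq sum_subtractf sum.distrib one sum_distrib_left by simp
  then have eq: "transfer_op X (\<lambda>x. (\<phi> x + \<xi> x) / 2) (\<lambda>_. 1) x = 1 - (\<Sum>y\<in>?P. ?d y) / 2"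
    by (simp add: transfer_op_def diff_divide_distrib)
  show "transfer_op X (\<lambda>x. (\<phi> x + \<xi> x) / 2) (\<lambda>_. 1) x \<le> 1"
    unfolding eq using sum_nonneg[of ?P ?d] by simp
  assume y: "y \<in> X" "shift y = x" "\<phi> y \<noteq> \<xi> y"
  have "(\<Sum>y\<in>?P. ?d y) > 0"
    by (rule sum_pos2[of _ y]) (use y finite_preimages in auto)
  then show "transfer_op X (\<lambda>x. (\<phi> x + \<xi> x) / 2) (\<lambda>_. 1) x < 1" unfolding eq by simp
qed

text \<open>The deficit of \<open>G = L\<^sub>\<psi> 1\<close> at one point persists on a cylinder by continuity, and every point has a
  preimage of order at most \<open>M\<close> there. The deficit reaches that point with a weight bounded below.
  As the functions \<open>L\<^sub>\<psi>\<^sup>n 1\<close> decrease with \<open>n\<close>, the order of the preimage does not matter.\<close>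

lemma affinity_uniformly_less_one:
  assumes np: "\<phi> \<in> normalized_potentials X" "\<xi> \<in> normalized_potentials X"
    and z: "z \<in> X" "\<phi> z \<noteq> \<xi> z"
  shows "\<exists>N>0. \<exists>r<1. 0 < r \<and> (\<forall>x\<in>X. (transfer_op X (\<lambda>x. (\<phi> x + \<xi> x) / 2) ^^ N) (\<lambda>_. 1) x \<le> r)"
proof -
  define \<psi> where "\<psi> = (\<lambda>x. (\<phi> x + \<xi> x) / 2)"
  define L where "L = transfer_op X \<psi>"
  define G where "G = L (\<lambda>_. 1)"
  have "bounded_lipschitz X (\<lambda>x. (1/2) * (\<phi> x + \<xi> x))"
    by (intro bounded_lipschitz_mult bounded_lipschitz_add bounded_lipschitz_const
        bounded_lipschitz_potential np)
  then have bl: "bounded_lipschitz X \<psi>" by (simp add: \<psi>_def)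
  have le1: "G x \<le> 1" if "x \<in> X" for x
    unfolding G_def L_def \<psi>_def using transfer_op_average_le_one(1)[OF np that] .
  have anti: "(L ^^ Suc n) (\<lambda>_. 1) x \<le> (L ^^ n) (\<lambda>_. 1) x" if "x \<in> X" for n x
    using that
  proof (induction n arbitrary: x)
    case 0
    then show ?case using le1 by (simp add: G_def)
  next
    case (Suc n)
    have "L ((L ^^ Suc n) (\<lambda>_. 1)) x \<le> L ((L ^^ n) (\<lambda>_. 1)) x"
      unfolding L_def using Suc.IH unfolding L_def by (rule transfer_op_mono)
    then show ?case by simp
  qed
  have anti': "(L ^^ n) (\<lambda>_. 1) x \<le> (L ^^ k) (\<lambda>_. 1) x" if "x \<in> X" "k \<le> n" for n k x
    using that(2)
  proof (induction n rule: dec_induct)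
    case (step n)
    then show ?case using anti[OF that(1), of n] by linarith
  qed simp
  \<comment> \<open>The potentials differ at \<open>z\<close>, a preimage of \<open>z'\<close>, so \<open>L\<^sub>\<psi> 1\<close> is less than 1 at \<open>z'\<close>.\<close>
  define z' where "z' = shift z"
  have z': "z' \<in> X" using z shift_in by (simp add: z'_def)
  define e where "e = (1 - G z') / 2"
  have "G z' < 1"
    unfolding G_def L_def \<psi>_def
    by (rule transfer_op_average_le_one(2)[where \<phi> = \<phi> and \<xi> = \<xi> and y = z])
      (use np z' z in \<open>simp_all add: z'_def\<close>)
  then have e: "e > 0" by (simp add: e_def)
  have "bounded_lipschitz X G"
    unfolding G_def L_def by (intro bounded_lipschitz_transfer_op bl bounded_lipschitz_const)
  then obtain B where B: "B > 0" "\<And>x y. x \<in> X \<Longrightarrow> y \<in> X \<Longrightarrow> \<bar>G x - G y\<bar> \<le> B * seq_dist x y"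
    by (rule bounded_lipschitzE) blast
  obtain l where l: "(1/2) ^ l < e / B"
    using real_arch_pow_inv[of "e / B" "1/2"] e B(1) by auto
  have near: "e \<le> 1 - G w" if "w \<in> X" "\<forall>j<l. w j = z' j" for w
  proof -
    have "B * seq_dist w z' \<le> B * (1/2) ^ Suc l"
      using that(2) seq_dist_le_iff[of w z' l] B(1) by (intro mult_left_mono) auto
    also have "\<dots> \<le> B * (1/2) ^ l" using B(1) by simp
    also have "\<dots> \<le> e" using l B(1) by (simp add: field_simps)
    finally have "G w \<le> G z' + e" using B(2)[OF that(1) z'] by linarith
    then show ?thesis by (simp add: e_def field_simps)
  qed
  obtain M where M: "\<forall>x\<in>X. \<forall>z\<in>X. \<exists>k\<le>M. \<exists>w\<in>X. (shift ^^ k) w = x \<and> (\<forall>j<l. w j = z j)"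
    using backward_orbits_dense by blast
  obtain b where b: "\<And>x. x \<in> X \<Longrightarrow> \<bar>\<psi> x\<bar> \<le> b"
    using bl by (rule bounded_lipschitzE) blast
  define r where "r = 1 - exp (- (M * b)) * e"
  have bound: "(L ^^ Suc M) (\<lambda>_. 1) x \<le> r" if x: "x \<in> X" for x
  proof -
    obtain k w where k: "k \<le> M" "w \<in> X" "(shift ^^ k) w = x" "\<forall>j<l. w j = z' j"
      using M x z' by blast
    have "exp (- (M * b)) * e \<le> exp (- (M * b)) * (1 - G w)"
      using near[OF k(2,4)] by (intro mult_left_mono) auto
    also have "\<dots> \<le> (L ^^ k) (\<lambda>x. 1 - G x) x"
      unfolding L_def by (rule transfer_op_funpow_ge) (use x k b le1 in auto)
    also have "\<dots> = (L ^^ k) (\<lambda>_. 1) x - (L ^^ k) G x"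
      unfolding L_def transfer_op_funpow[OF x] by (simp add: right_diff_distrib sum_subtractf)
    also have "(L ^^ k) G x = (L ^^ Suc k) (\<lambda>_. 1) x" by (simp add: G_def funpow_swap1)
    finally have "exp (- (M * b)) * e \<le> (L ^^ k) (\<lambda>_. 1) x - (L ^^ Suc k) (\<lambda>_. 1) x" .
    moreover have "(L ^^ k) (\<lambda>_. 1) x \<le> 1" using anti'[OF x, of 0 k] by simp
    moreover have "(L ^^ Suc M) (\<lambda>_. 1) x \<le> (L ^^ Suc k) (\<lambda>_. 1) x" by (rule anti'[OF x]) (use k in simp)
    ultimately show ?thesis unfolding r_def by linarith
  qed
  have "r < 1" using e by (simp add: r_def)
  then show ?thesis
    using bound unfolding L_def \<psi>_def
    by (intro exI[of _ "Suc M"] conjI exI[of _ "max r (1/2)"]) (auto simp: le_max_iff_disj)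
qed

lemma affinity_decay:
  assumes np: "\<phi> \<in> normalized_potentials X" "\<xi> \<in> normalized_potentials X"
    and z: "z \<in> X" "\<phi> z \<noteq> \<xi> z"
  obtains C c where "c > 0"
    "\<And>n x. x \<in> X \<Longrightarrow> (transfer_op X (\<lambda>x. (\<phi> x + \<xi> x) / 2) ^^ n) (\<lambda>_. 1) x \<le> C * exp (- c * n)"
proof -
  define L where "L = transfer_op X (\<lambda>x. (\<phi> x + \<xi> x) / 2)"
  obtain N r where N: "N > 0" "r < 1" "0 < r" "\<And>x. x \<in> X \<Longrightarrow> (L ^^ N) (\<lambda>_. 1) x \<le> r"
    using affinity_uniformly_less_one[where \<phi> = \<phi> and \<xi> = \<xi>, OF assms] unfolding L_def by blast
  have pow_le1: "(L ^^ i) (\<lambda>_. 1) x \<le> 1" if "x \<in> X" for i x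
    using that
  proof (induction i arbitrary: x)
    case (Suc i)
    have "L ((L ^^ i) (\<lambda>_. 1)) x \<le> L (\<lambda>_. 1) x"
      unfolding L_def using Suc.IH unfolding L_def by (rule transfer_op_mono)
    also have "\<dots> \<le> 1" unfolding L_def by (rule transfer_op_average_le_one(1)[OF np Suc.prems])
    finally show ?case by simp
  qed simp
  have pow_N: "(L ^^ (k * N + i)) (\<lambda>_. 1) x \<le> r ^ k" if "x \<in> X" for k i x
    using that
  proof (induction k arbitrary: x)
    case 0
    then show ?case using pow_le1 by simp
  next
    case (Suc k)
    have "(L ^^ (Suc k * N + i)) (\<lambda>_. 1) x = (L ^^ N) ((L ^^ (k * N + i)) (\<lambda>_. 1)) x"
      by (simp add: funpow_add add.assoc)
    also have "\<dots> \<le> (L ^^ N) (\<lambda>_. r ^ k * 1) x"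
      unfolding L_def transfer_op_funpow[OF Suc.prems]
      using Suc.IH[unfolded L_def] by (intro sum_mono mult_left_mono) auto
    also have "\<dots> = r ^ k * (L ^^ N) (\<lambda>_. 1) x"
      unfolding L_def transfer_op_funpow[OF Suc.prems] by (simp add: sum_distrib_left mult_ac)
    also have "\<dots> \<le> r ^ k * r" using N(3,4) Suc.prems by (intro mult_left_mono) auto
    finally show ?case by (simp add: mult_ac)
  qed
  \<comment> \<open>The rate for which \<open>exp (- c N) = r\<close>; writing \<open>n = k N + i\<close> costs a factor \<open>exp (c N)\<close>.\<close>
  define c where "c = - ln r / N"
  have c: "c > 0" using N by (simp add: c_def field_simps)
  have r: "r = exp (- c * N)" using N by (simp add: c_def)
  show ?thesis
  proof (rule that[OF c, of "exp (c * N)"])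
    fix n x assume x: "x \<in> X"
    have "(L ^^ n) (\<lambda>_. 1) x \<le> r ^ (n div N)"
      using pow_N[OF x, of "n div N" "n mod N"] by simp
    also have "\<dots> = exp (- c * (real N * real (n div N)))"
      unfolding r exp_of_nat_mult[symmetric] by (simp add: mult_ac)
    also have "\<dots> \<le> exp (c * N) * exp (- c * n)"
    proof -
      have "n \<le> N * (n div N) + N"
        using mod_less_divisor[OF N(1), of n] mult_div_mod_eq[of N n] by linarith
      then have "real n \<le> real N * real (n div N) + N"
        by (metis of_nat_add of_nat_le_iff of_nat_mult)
      then have "c * real n \<le> c * (real N * real (n div N) + N)" using c by (intro mult_left_mono) auto
      then show ?thesis unfolding mult_exp_exp by (simp add: algebra_simps)
    qed
    finally show "(transfer_op X (\<lambda>x. (\<phi> x + \<xi> x) / 2) ^^ n) (\<lambda>_. 1) x \<le> exp (c * N) * exp (- c * n)"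
      unfolding L_def .
  qed
qed

lemma bounded_lipschitz_root_ratio:
  assumes "bounded_lipschitz X \<phi>" "bounded_lipschitz X \<xi>"
  shows "bounded_lipschitz X (\<lambda>x. exp ((birkhoff_sum \<xi> n x - birkhoff_sum \<phi> n x) / 2))"
proof -
  have "bounded_lipschitz X (\<lambda>x. exp ((1/2) * birkhoff_sum \<xi> n x + (-1/2) * birkhoff_sum \<phi> n x))"
    by (intro bounded_lipschitz_exp bounded_lipschitz_add bounded_lipschitz_mult
        bounded_lipschitz_const bounded_lipschitz_birkhoff_sum assms)
  then show ?thesis by (simp add: diff_divide_distrib)
qed

text \<open>By induction on \<open>n\<close>: one application of \<open>L\<^sub>\<phi>\<close> absorbs the first factor
  \<open>exp ((\<xi> - \<phi>)/2)\<close> of the product into the weight \<open>exp \<phi>\<close>, which becomes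
  \<open>exp ((\<phi> + \<xi>)/2)\<close>. The test function \<open>h\<close> is there for the induction.\<close>

lemma integral_root_ratio:
  assumes m: "gibbs_measure X \<phi> m" and bl: "bounded_lipschitz X \<phi>" "bounded_lipschitz X \<xi>"
    and h: "bounded_lipschitz X h"
  shows "(\<integral>x. exp ((birkhoff_sum \<xi> n x - birkhoff_sum \<phi> n x) / 2) * h x \<partial>m) =
    (\<integral>x. (transfer_op X (\<lambda>x. (\<phi> x + \<xi> x) / 2) ^^ n) h x \<partial>m)"
  using h
proof (induction n arbitrary: h)
  case (Suc n)
  define \<psi> where "\<psi> = (\<lambda>x. (\<phi> x + \<xi> x) / 2)"
  let ?R = "\<lambda>n x. exp ((birkhoff_sum \<xi> n x - birkhoff_sum \<phi> n x) / 2)"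
  have "bounded_lipschitz X (\<lambda>x. (1/2) * (\<phi> x + \<xi> x))"
    by (intro bounded_lipschitz_mult bounded_lipschitz_add bounded_lipschitz_const bl)
  then have \<psi>: "bounded_lipschitz X \<psi>" by (simp add: \<psi>_def)
  have "transfer_op X \<phi> (\<lambda>x. ?R (Suc n) x * h x) x = ?R n x * transfer_op X \<psi> h x" for x
    unfolding transfer_op_def sum_distrib_left
  proof (rule sum.cong[OF refl])
    fix y assume "y \<in> {y. y \<in> X \<and> shift y = x}"
    then have "exp (\<phi> y) * ?R (Suc n) y = ?R n x * exp (\<psi> y)"
      unfolding mult_exp_exp by (simp add: birkhoff_sum_Suc \<psi>_def field_simps)
    then show "exp (\<phi> y) * (?R (Suc n) y * h y) = ?R n x * (exp (\<psi> y) * h y)"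
      by (metis mult.assoc)
  qed
  moreover have "(\<integral>x. transfer_op X \<phi> (\<lambda>x. ?R (Suc n) x * h x) x \<partial>m) = (\<integral>x. ?R (Suc n) x * h x \<partial>m)"
    by (intro integral_transfer_op[OF m] bounded_lipschitz_mult bounded_lipschitz_root_ratio bl Suc.prems)
  ultimately have "(\<integral>x. ?R (Suc n) x * h x \<partial>m) = (\<integral>x. ?R n x * transfer_op X \<psi> h x \<partial>m)"
    by simp
  also have "\<dots> = (\<integral>x. (transfer_op X \<psi> ^^ n) (transfer_op X \<psi> h) x \<partial>m)"
    using Suc.IH[of "transfer_op X \<psi> h"] bounded_lipschitz_transfer_op[OF \<psi> Suc.prems]
    unfolding \<psi>_def by blast
  finally show ?case by (simp add: \<psi>_def funpow_swap1)
qed simp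

text \<open>The integral of the square root of the likelihood ratio decays like \<open>exp (- c n)\<close>, so the event that
  it exceeds \<open>exp (- c n / 2)\<close> has summable probabilities.\<close>

lemma AE_birkhoff_sum_gap:
  assumes np: "\<phi> \<in> normalized_potentials X" "\<xi> \<in> normalized_potentials X"
    and z: "z \<in> X" "\<phi> z \<noteq> \<xi> z"
    and m: "gibbs_measure X \<phi> m"
  shows "\<exists>c>0. AE y in m. \<forall>\<^sub>F n in sequentially. birkhoff_sum \<xi> n y \<le> birkhoff_sum \<phi> n y - c * real n"
proof -
  interpret prob_space m using m by (rule gibbs_measure_props)
  note bl = np[THEN bounded_lipschitz_potential]
  obtain C c where c: "c > 0"
    and C: "\<And>n x. x \<in> X \<Longrightarrow> (transfer_op X (\<lambda>x. (\<phi> x + \<xi> x) / 2) ^^ n) (\<lambda>_. 1) x \<le> C * exp (- c * n)"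
    by (rule affinity_decay[where \<phi> = \<phi> and \<xi> = \<xi>, OF np z]) (rule that; assumption)
  let ?R = "\<lambda>n x. exp ((birkhoff_sum \<xi> n x - birkhoff_sum \<phi> n x) / 2)"
  have intR: "integrable m (?R n)" for n
    by (intro integrable_gibbs[OF m] bounded_lipschitz_root_ratio bl)
  have "bounded_lipschitz X (\<lambda>x. (1/2) * (\<phi> x + \<xi> x))"
    by (intro bounded_lipschitz_mult bounded_lipschitz_add bounded_lipschitz_const bl)
  then have \<psi>: "bounded_lipschitz X (\<lambda>x. (\<phi> x + \<xi> x) / 2)" by simp
  have ER: "(\<integral>x. ?R n x \<partial>m) \<le> C * exp (- c * n)" for n
  proof -
    have "(\<integral>x. ?R n x \<partial>m) = (\<integral>x. (transfer_op X (\<lambda>x. (\<phi> x + \<xi> x) / 2) ^^ n) (\<lambda>_. 1) x \<partial>m)"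
      using integral_root_ratio[OF m bl bounded_lipschitz_const[of X 1], of n] by simp
    also have "\<dots> \<le> C * exp (- c * n)"
      using gibbs_measure_props(2)[OF m] C
      by (intro integral_le_const integrable_gibbs[OF m] bounded_lipschitz_transfer_op_funpow \<psi>
          bounded_lipschitz_const) auto
    finally show ?thesis .
  qed
  define E where "E = (\<lambda>n::nat. {x \<in> space m. ?R n x \<ge> exp (- c * n / 2)})"
  have [measurable]: "?R n \<in> borel_measurable m" for n using intR by (rule borel_measurable_integrable)
  have E_sets: "E n \<in> sets m" for n unfolding E_def by measurable
  have mE: "measure m (E n) \<le> C * exp (- c / 2) ^ n" for n
  proof -
    have "measure m (E n) \<le> (\<integral>x. ?R n x \<partial>m) / exp (- c * n / 2)"
      unfolding E_def by (rule integral_Markov_inequality_measure[OF intR, of "{}"]) auto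
    also have "\<dots> \<le> C * exp (- c * n) / exp (- c * n / 2)"
      by (intro divide_right_mono ER) auto
    also have "\<dots> = C * exp (- c * n - (- c * n / 2))" by (simp only: exp_diff times_divide_eq_right)
    also have "\<dots> = C * exp (- c / 2) ^ n"
      unfolding exp_of_nat_mult[symmetric] by (simp add: field_simps)
    finally show ?thesis .
  qed
  have "summable (\<lambda>n. measure m (E n))"
    by (rule summable_comparison_test'[of "\<lambda>n. C * exp (- c / 2) ^ n" 0])
      (use mE c in \<open>auto intro!: summable_mult summable_geometric\<close>)
  then have "AE x in m. eventually (\<lambda>n. x \<in> space m - E n) sequentially"
    by (intro borel_cantelli_AE1 E_sets) (auto simp: emeasure_eq_measure)
  then have "AE y in m. \<forall>\<^sub>F n in sequentially. birkhoff_sum \<xi> n y \<le> birkhoff_sum \<phi> n y - c * real n"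
  proof (eventually_elim)
    case (elim y)
    then show ?case
      by (rule eventually_mono) (auto simp: E_def)
  qed
  with c show ?thesis by blast
qed

section \<open>Uniqueness of Gibbs measures by contraction of the lazy transfer operator\<close>

text \<open>The transfer operator itself may act periodically on 1-cylinders, and its iterates then need not
  converge. Averaging with the identity removes the periodicity.\<close>

definition lazy_op :: "((nat \<Rightarrow> nat) \<Rightarrow> real) \<Rightarrow> ((nat \<Rightarrow> nat) \<Rightarrow> real) \<Rightarrow> (nat \<Rightarrow> nat) \<Rightarrow> real" where
  "lazy_op \<phi> g x = (g x + transfer_op X \<phi> g x) / 2"

text \<open>Oscillation and Lipschitz constant are tracked separately because the contraction argument plays
  them against each other. The Lipschitz estimate is restricted to pairs with a common first symbol,
  for which the preimages correspond.\<close>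

definition osc_lip :: "((nat \<Rightarrow> nat) \<Rightarrow> real) \<Rightarrow> real \<Rightarrow> real \<Rightarrow> bool" where
  "osc_lip g c l \<longleftrightarrow> (\<forall>x\<in>X. \<forall>y\<in>X. \<bar>g x - g y\<bar> \<le> c \<and> (x 0 = y 0 \<longrightarrow> \<bar>g x - g y\<bar> \<le> l * seq_dist x y))"

lemma lazy_op_funpow_Suc:
  "(lazy_op \<phi> ^^ Suc n) g x =
    ((lazy_op \<phi> ^^ n) g x + transfer_op X \<phi> ((lazy_op \<phi> ^^ n) g) x) / 2"
  by (simp add: lazy_op_def)

lemma lazy_op_near:
  assumes \<phi>: "\<phi> \<in> normalized_potentials X" and x: "x \<in> X"
    and a: "\<And>u. u \<in> X \<Longrightarrow> \<bar>g u - a\<bar> \<le> c"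
  shows "\<bar>lazy_op \<phi> g x - a\<bar> \<le> c"
proof -
  let ?P = "{y. y \<in> X \<and> shift y = x}"
  have one: "(\<Sum>y\<in>?P. exp (\<phi> y)) = 1" using transfer_op_one[OF \<phi> x] by (simp add: transfer_op_def)
  have "transfer_op X \<phi> g x - a = (\<Sum>y\<in>?P. exp (\<phi> y) * g y) - a * (\<Sum>y\<in>?P. exp (\<phi> y))"
    by (simp add: one transfer_op_def)
  also have "\<dots> = (\<Sum>y\<in>?P. exp (\<phi> y) * (g y - a))"
    by (simp add: sum_distrib_left right_diff_distrib sum_subtractf mult_ac)
  finally have "\<bar>transfer_op X \<phi> g x - a\<bar> \<le> (\<Sum>y\<in>?P. \<bar>exp (\<phi> y) * (g y - a)\<bar>)"
    by (simp only: sum_abs)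
  also have "\<dots> \<le> (\<Sum>y\<in>?P. exp (\<phi> y) * c)"
    by (intro sum_mono) (use a in \<open>auto simp: abs_mult\<close>)
  also have "\<dots> = c" unfolding sum_distrib_right[symmetric] one by simp
  finally show ?thesis using a[OF x] unfolding lazy_op_def by (simp add: field_simps)
qed

text \<open>A Lasota-Yorke inequality: the halving of distances contributes half the Lipschitz constant for the
  transfer operator, hence \<open>3/4\<close> for the lazy one. The variation of the weights contributes a
  multiple of the oscillation only, because the weights have sum 1 at both points, so that a
  constant may be subtracted from \<open>g\<close>.\<close>

lemma osc_lip_lazy_op:
  assumes \<phi>: "\<phi> \<in> normalized_potentials X"
  shows "\<exists>B>0. \<forall>g c l. 0 \<le> l \<longrightarrow> osc_lip g c l \<longrightarrow> osc_lip (lazy_op \<phi> g) c (3/4 * l + B * c)"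
proof -
  obtain B where B: "B > 0"
    "\<And>x y. x \<in> X \<Longrightarrow> y \<in> X \<Longrightarrow> \<bar>exp (\<phi> x) - exp (\<phi> y)\<bar> \<le> B * seq_dist x y"
    using bounded_lipschitz_exp[OF bounded_lipschitz_potential[OF \<phi>]] by (rule bounded_lipschitzE) blast
  show ?thesis
  proof (intro exI[of _ "(real q + 1) * B"] conjI allI impI)
    show "0 < (real q + 1) * B" using B(1) by (intro mult_pos_pos) auto
    fix g c l assume l: "0 \<le> l" and g: "osc_lip g c l"
    have osc: "\<bar>g x - g y\<bar> \<le> c" if "x \<in> X" "y \<in> X" for x y
      using g that by (simp add: osc_lip_def)
    have lip: "\<bar>g x - g y\<bar> \<le> l * seq_dist x y" if "x \<in> X" "y \<in> X" "x 0 = y 0" for x y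
      using g that by (simp add: osc_lip_def)
    show "osc_lip (lazy_op \<phi> g) c (3/4 * l + (real q + 1) * B * c)"
      unfolding osc_lip_def
    proof (intro ballI conjI impI)
      fix x y assume x: "x \<in> X" and y: "y \<in> X"
      have "\<bar>g u - lazy_op \<phi> g y\<bar> \<le> c" if "u \<in> X" for u
        using lazy_op_near[OF \<phi> y, of g "g u" c] osc that by (simp add: abs_minus_commute)
      then show "\<bar>lazy_op \<phi> g x - lazy_op \<phi> g y\<bar> \<le> c"
        using lazy_op_near[OF \<phi> x, of g "lazy_op \<phi> g y" c] by blast
      assume xy: "x 0 = y 0"
      have c: "0 \<le> c" using osc[OF x y] by linarith
      define I where "I = {i. i \<in> {1..q} \<and> A i (x 0) = 1}"
      have inX: "case_nat i x \<in> X" "case_nat i y \<in> X" if "i \<in> I" for i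
        using that xy x y by (auto simp: I_def intro!: case_nat_in)
      let ?J = "\<lambda>x i. exp (\<phi> (case_nat i x))" and ?g = "\<lambda>x i. g (case_nat i x)"
      have Lx: "transfer_op X \<phi> h x = (\<Sum>i\<in>I. ?J x i * h (case_nat i x))" for h
        unfolding I_def by (rule transfer_op_symbols[OF x])
      have Ly: "transfer_op X \<phi> h y = (\<Sum>i\<in>I. ?J y i * h (case_nat i y))" for h
        unfolding I_def xy by (rule transfer_op_symbols[OF y])
      have one: "(\<Sum>i\<in>I. ?J x i) = 1" "(\<Sum>i\<in>I. ?J y i) = 1"
        using Lx[of "\<lambda>_. 1"] Ly[of "\<lambda>_. 1"] transfer_op_one[OF \<phi>] x y by auto
      \<comment> \<open>The subtracted constant is \<open>g x\<close>; it cancels because \<open>?J x\<close> and \<open>?J y\<close> have the same sum.\<close>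
      have decomp: "transfer_op X \<phi> g x - transfer_op X \<phi> g y =
          (\<Sum>i\<in>I. ?J x i * (?g x i - ?g y i)) + (\<Sum>i\<in>I. (?J x i - ?J y i) * (?g y i - g x))"
      proof -
        have "?J x i * (?g x i - ?g y i) + (?J x i - ?J y i) * (?g y i - g x) =
          ?J x i * ?g x i - ?J y i * ?g y i - g x * (?J x i - ?J y i)" for i
          by (simp add: algebra_simps)
        then have "(\<Sum>i\<in>I. ?J x i * (?g x i - ?g y i)) + (\<Sum>i\<in>I. (?J x i - ?J y i) * (?g y i - g x))
          = (\<Sum>i\<in>I. ?J x i * ?g x i - ?J y i * ?g y i - g x * (?J x i - ?J y i))"
          by (simp only: sum.distrib[symmetric])
        also have "\<dots> = transfer_op X \<phi> g x - transfer_op X \<phi> g y - g x * (1 - 1)"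
          unfolding sum_subtractf sum_distrib_left[symmetric] one Lx Ly ..
        finally show ?thesis by simp
      qed
      have L: "\<bar>transfer_op X \<phi> g x - transfer_op X \<phi> g y\<bar>
          \<le> l * seq_dist x y / 2 + real q * B * c * seq_dist x y"
        unfolding decomp
      proof (rule order_trans[OF abs_triangle_ineq add_mono])
        have "\<bar>\<Sum>i\<in>I. ?J x i * (?g x i - ?g y i)\<bar> \<le> (\<Sum>i\<in>I. ?J x i * (l * seq_dist x y / 2))"
        proof (rule order_trans[OF sum_abs sum_mono])
          fix i assume i: "i \<in> I"
          have "\<bar>?g x i - ?g y i\<bar> \<le> l * seq_dist (case_nat i x) (case_nat i y)"
            using inX[OF i] by (intro lip) auto
          also have "\<dots> \<le> l * (seq_dist x y / 2)" using l by (intro mult_left_mono seq_dist_case_nat)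
          finally show "\<bar>?J x i * (?g x i - ?g y i)\<bar> \<le> ?J x i * (l * seq_dist x y / 2)"
            by (simp add: abs_mult)
        qed
        also have "\<dots> = l * seq_dist x y / 2" unfolding sum_distrib_right[symmetric] one by simp
        finally show "\<bar>\<Sum>i\<in>I. ?J x i * (?g x i - ?g y i)\<bar> \<le> l * seq_dist x y / 2" .
        have "\<bar>\<Sum>i\<in>I. (?J x i - ?J y i) * (?g y i - g x)\<bar> \<le> (\<Sum>i\<in>I. B * seq_dist x y * c)"
        proof (rule order_trans[OF sum_abs sum_mono])
          fix i assume i: "i \<in> I"
          have "\<bar>?J x i - ?J y i\<bar> \<le> B * seq_dist (case_nat i x) (case_nat i y)"
            using inX[OF i] by (intro B)
          also have "\<dots> \<le> B * seq_dist x y"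
            using B(1) seq_dist_case_nat[of i x y] seq_dist_nonneg[of x y] by (intro mult_left_mono) auto
          finally show "\<bar>(?J x i - ?J y i) * (?g y i - g x)\<bar> \<le> B * seq_dist x y * c"
            unfolding abs_mult using inX[OF i] x B(1) seq_dist_nonneg[of x y]
            by (intro mult_mono osc) auto
        qed
        also have "\<dots> = real (card I) * (B * seq_dist x y * c)" by simp
        also have "\<dots> \<le> real q * (B * seq_dist x y * c)"
        proof (intro mult_right_mono)
          have "I \<subseteq> {1..q}" by (auto simp: I_def)
          then show "real (card I) \<le> real q" using card_mono[of "{1..q}" I] by simp
        qed (use B(1) c seq_dist_nonneg[of x y] in auto)
        finally show "\<bar>\<Sum>i\<in>I. (?J x i - ?J y i) * (?g y i - g x)\<bar> \<le> real q * B * c * seq_dist x y"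
          by (simp add: mult_ac)
      qed
      have nn: "0 \<le> B * c * seq_dist x y" "0 \<le> real q * B * c * seq_dist x y"
        using B(1) c seq_dist_nonneg[of x y] by auto
      have eq: "lazy_op \<phi> g x - lazy_op \<phi> g y =
          ((g x - g y) + (transfer_op X \<phi> g x - transfer_op X \<phi> g y)) / 2"
        unfolding lazy_op_def by (simp add: field_simps)
      have "\<bar>lazy_op \<phi> g x - lazy_op \<phi> g y\<bar>
          \<le> (\<bar>g x - g y\<bar> + \<bar>transfer_op X \<phi> g x - transfer_op X \<phi> g y\<bar>) / 2"
        unfolding eq abs_divide
        using abs_triangle_ineq[of "g x - g y" "transfer_op X \<phi> g x - transfer_op X \<phi> g y"]
        by simp
      also have "\<dots> \<le> (l * seq_dist x y + (l * seq_dist x y / 2 + real q * B * c * seq_dist x y)) / 2"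
        using lip[OF x y xy] L by simp
      also have "\<dots> \<le> (3/4) * (l * seq_dist x y) + real q * B * c * seq_dist x y + B * c * seq_dist x y"
      proof -
        have "(u + (u / 2 + v)) / 2 \<le> 3/4 * u + v + w" if "0 \<le> w" "0 \<le> v" for u v w :: real
          using that by argo
        from this[OF nn] show ?thesis .
      qed
      finally show "\<bar>lazy_op \<phi> g x - lazy_op \<phi> g y\<bar> \<le> (3/4 * l + (real q + 1) * B * c) * seq_dist x y"
        by (simp add: algebra_simps)
    qed
  qed
qed

text \<open>In \<open>((1 + L)/2)\<^sup>M\<close>, expanded into powers of \<open>L\<close>, every \<open>L\<^sup>k\<close> with \<open>k \<le> M\<close> has at least
  the coefficient \<open>(1/2)\<^sup>M\<close>.\<close>

lemma lazy_op_funpow_ge: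
  assumes "\<And>x. x \<in> X \<Longrightarrow> 0 \<le> g x" "k \<le> M" "x \<in> X"
  shows "(1/2) ^ M * (transfer_op X \<phi> ^^ k) g x \<le> (lazy_op \<phi> ^^ M) g x"
proof -
  have nonneg: "0 \<le> transfer_op X \<phi> h x" if "\<And>x. x \<in> X \<Longrightarrow> 0 \<le> h x" for h x
    unfolding transfer_op_def by (intro sum_nonneg) (use that in auto)
  have L0: "0 \<le> (transfer_op X \<phi> ^^ k) g x" if "x \<in> X" for k x
    unfolding transfer_op_funpow[OF that] by (intro sum_nonneg) (use assms(1) in auto)
  show ?thesis
    using assms(2,3)
  proof (induction M arbitrary: k x)
    case (Suc M)
    have Q0: "0 \<le> (lazy_op \<phi> ^^ M) g x" if "x \<in> X" for x
      by (rule order_trans[OF _ Suc.IH[of 0]]) (use L0[of x 0] that in auto)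
    show ?case
    proof (cases "k \<le> M")
      case True
      then show ?thesis
        using Suc.IH[OF True Suc.prems(2)] nonneg[of "(lazy_op \<phi> ^^ M) g" x, OF Q0]
        unfolding lazy_op_funpow_Suc by simp
    next
      case False
      then have k: "k = Suc M" using Suc.prems by simp
      have "(1/2) ^ M * (transfer_op X \<phi> ^^ k) g x = transfer_op X \<phi> (\<lambda>x. (1/2) ^ M * (transfer_op X \<phi> ^^ M) g x) x"
        unfolding k transfer_op_scale by simp
      also have "\<dots> \<le> transfer_op X \<phi> ((lazy_op \<phi> ^^ M) g) x"
        by (rule transfer_op_mono) (rule Suc.IH[OF order_refl])
      finally show ?thesis
        using Q0[OF Suc.prems(2)] unfolding lazy_op_funpow_Suc by simp
    qed
  qed simp
qed

lemma lazy_op_funpow_affine: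
  assumes \<phi>: "\<phi> \<in> normalized_potentials X" and "x \<in> X"
  shows "(lazy_op \<phi> ^^ n) (\<lambda>x. a + s * g x) x = a + s * (lazy_op \<phi> ^^ n) g x"
  using assms(2)
proof (induction n arbitrary: x)
  case (Suc n)
  have one: "(\<Sum>y | y \<in> X \<and> shift y = x. exp (\<phi> y)) = 1"
    using transfer_op_one[OF \<phi> Suc.prems] by (simp add: transfer_op_def)
  have "transfer_op X \<phi> ((lazy_op \<phi> ^^ n) (\<lambda>x. a + s * g x)) x =
    (\<Sum>y | y \<in> X \<and> shift y = x. exp (\<phi> y) * a + s * (exp (\<phi> y) * (lazy_op \<phi> ^^ n) g y))"
    unfolding transfer_op_def by (rule sum.cong) (auto simp: Suc.IH algebra_simps)
  also have "\<dots> = a + s * transfer_op X \<phi> ((lazy_op \<phi> ^^ n) g) x"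
    unfolding sum.distrib sum_distrib_right[symmetric] sum_distrib_left[symmetric] one
    by (simp add: transfer_op_def)
  finally show ?case
    unfolding lazy_op_funpow_Suc Suc.IH[OF Suc.prems] by (simp add: field_simps)
qed simp

lemma osc_lip_lazy_op_funpow:
  assumes B: "B > 0"
    "\<And>g c l. 0 \<le> l \<Longrightarrow> osc_lip g c l \<Longrightarrow> osc_lip (lazy_op \<phi> g) c (3/4 * l + B * c)"
    and g: "0 \<le> c" "0 \<le> l" "osc_lip g c l"
  shows "osc_lip ((lazy_op \<phi> ^^ n) g) c ((3/4) ^ n * l + 4 * B * c)"
proof (induction n)
  case 0
  have "l * seq_dist x y \<le> (l + 4 * B * c) * seq_dist x y" for x y
    using B(1) g(1) by (intro mult_right_mono seq_dist_nonneg) auto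
  then have "osc_lip g c (l + 4 * B * c)"
    using g(3) order_trans unfolding osc_lip_def by blast
  then show ?case by simp
next
  case (Suc n)
  have "osc_lip (lazy_op \<phi> ((lazy_op \<phi> ^^ n) g)) c (3/4 * ((3/4) ^ n * l + 4 * B * c) + B * c)"
    using B(1) g by (intro B Suc) auto
  then show ?case by (simp add: algebra_simps)
qed

text \<open>A Doeblin argument. Every point has a preimage of order at most \<open>M\<close> near the place where \<open>g\<close> is almost
  maximal, so \<open>M\<close> lazy steps raise the infimum by a fraction \<open>\<kappa>\<close> of the oscillation, up to an error
  proportional to the Lipschitz constant. Conversely the new Lipschitz constant has an error
  proportional to the oscillation. With a small weight \<open>t\<close> on the Lipschitz constant both errors
  are absorbed.\<close>

lemma lazy_op_contraction:
  assumes \<phi>: "\<phi> \<in> normalized_potentials X" and ne: "X \<noteq> {}"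
  obtains M :: nat and t \<gamma> :: real where "0 < t" "0 \<le> \<gamma>" "\<gamma> < 1"
    "\<And>g c l. 0 \<le> c \<Longrightarrow> 0 \<le> l \<Longrightarrow> osc_lip g c l \<Longrightarrow>
       \<exists>c' l'. 0 \<le> c' \<and> 0 \<le> l' \<and> osc_lip ((lazy_op \<phi> ^^ M) g) c' l' \<and> c' + t * l' \<le> \<gamma> * (c + t * l)"
proof -
  obtain B where B: "B > 0"
    "\<And>g c l. 0 \<le> l \<Longrightarrow> osc_lip g c l \<Longrightarrow> osc_lip (lazy_op \<phi> g) c (3/4 * l + B * c)"
    using osc_lip_lazy_op[OF \<phi>] by blast
  \<comment> \<open>The precision \<open>\<epsilon>\<close> is chosen first; it determines \<open>M\<close>, hence \<open>\<kappa>\<close>, and only then the weight \<open>t\<close>.\<close>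
  obtain s where s: "(1/2) ^ s < 1 / (64 * B)"
    using real_arch_pow_inv[of "1 / (64 * B)" "1/2"] B(1) by auto
  define \<epsilon> where "\<epsilon> = (1/2 :: real) ^ Suc (Suc s)"
  have \<epsilon>: "0 < \<epsilon>" "8 * B * \<epsilon> \<le> 1/8" using s B(1) by (auto simp: \<epsilon>_def field_simps)
  obtain M0 where M0: "\<forall>x\<in>X. \<forall>z\<in>X. \<exists>k\<le>M0. \<exists>w\<in>X. (shift ^^ k) w = x \<and> (\<forall>j<Suc s. w j = z j)"
    using backward_orbits_dense by blast
  define M where "M = Suc M0"
  obtain b where b: "\<And>x. x \<in> X \<Longrightarrow> \<bar>\<phi> x\<bar> \<le> b"
    using bounded_lipschitz_potential[OF \<phi>] by (rule bounded_lipschitzE) blast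
  have b0: "0 \<le> b" using b ne by force
  define \<kappa> where "\<kappa> = (1/2) ^ M * exp (- (M * b))"
  have "(1/2 :: real) ^ M * exp (- (M * b)) \<le> 1 * 1"
    using b0 by (intro mult_mono power_le_one) auto
  then have \<kappa>: "0 < \<kappa>" "\<kappa> \<le> 1" by (auto simp: \<kappa>_def)
  define t where "t = \<kappa> / (8 * B)"
  define \<gamma> where "\<gamma> = max (1 - \<kappa> / 2) (7/8)"
  show ?thesis
  proof (rule that[of t \<gamma> M])
    show "0 < t" "0 \<le> \<gamma>" "\<gamma> < 1" using \<kappa> B(1) by (auto simp: t_def \<gamma>_def)
    fix g c l assume c: "0 \<le> c" and l: "0 \<le> l" and g: "osc_lip g c l"
    have osc: "\<bar>g x - g y\<bar> \<le> c" if "x \<in> X" "y \<in> X" for x y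
      using g that by (simp add: osc_lip_def)
    obtain p where p: "p \<in> X" using ne by blast
    have bdd: "bdd_below (g ` X)" "bdd_above (g ` X)"
      using osc[OF _ p] by (intro bdd_belowI2[of _ "g p - c"] bdd_aboveI2[of _ _ "g p + c"]; force)+
    define \<alpha> where "\<alpha> = (INF x\<in>X. g x)"
    define \<beta> where "\<beta> = (SUP x\<in>X. g x)"
    have \<alpha>: "\<alpha> \<le> g x" and \<beta>: "g x \<le> \<beta>" if "x \<in> X" for x
      using that bdd by (auto simp: \<alpha>_def \<beta>_def intro: cINF_lower cSUP_upper)
    have width: "\<beta> - \<alpha> \<le> c"
    proof -
      have "\<beta> - c \<le> g y" if "y \<in> X" for y
      proof -
        have "g x \<le> g y + c" if "x \<in> X" for x using osc[OF that \<open>y \<in> X\<close>] by linarith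
        then have "\<beta> \<le> g y + c" unfolding \<beta>_def by (intro cSUP_least ne)
        then show ?thesis by linarith
      qed
      then have "\<beta> - c \<le> \<alpha>" unfolding \<alpha>_def by (intro cINF_greatest ne)
      then show ?thesis by linarith
    qed
    let ?Q = "lazy_op \<phi> ^^ M"
    have lower: "\<alpha> + \<kappa> * (\<beta> - \<alpha> - l * \<epsilon>) \<le> ?Q g x" if x: "x \<in> X" for x
    proof -
      have "g z \<le> \<alpha> + l * \<epsilon> + (?Q g x - \<alpha>) / \<kappa>" if z: "z \<in> X" for z
      proof -
        obtain k w where k: "k \<le> M0" "w \<in> X" "(shift ^^ k) w = x" "\<forall>j<Suc s. w j = z j"
          using M0 x z by blast
        have "\<bar>g w - g z\<bar> \<le> l * seq_dist w z"
          using g k z by (auto simp: osc_lip_def)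
        also have "\<dots> \<le> l * \<epsilon>"
          using k(4) l seq_dist_le_iff[of w z "Suc s"] unfolding \<epsilon>_def by (intro mult_left_mono) auto
        finally have gw: "g z - l * \<epsilon> \<le> g w" by linarith
        have "\<kappa> * (g w - \<alpha>) = (1/2) ^ M * (exp (- (M * b)) * (g w - \<alpha>))" by (simp add: \<kappa>_def)
        also have "\<dots> \<le> (1/2) ^ M * (transfer_op X \<phi> ^^ k) (\<lambda>x. g x - \<alpha>) x"
          by (intro mult_left_mono transfer_op_funpow_ge) (use x k b \<alpha> in \<open>auto simp: M_def\<close>)
        also have "\<dots> \<le> ?Q (\<lambda>x. g x - \<alpha>) x"
          by (rule lazy_op_funpow_ge) (use x k \<alpha> in \<open>auto simp: M_def\<close>)
        also have "\<dots> = ?Q g x - \<alpha>" using lazy_op_funpow_affine[OF \<phi> x, of M "- \<alpha>" 1 g] by simp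
        finally have "g w - \<alpha> \<le> (?Q g x - \<alpha>) / \<kappa>" using \<kappa>(1) by (simp add: field_simps)
        then show ?thesis using gw by linarith
      qed
      then have "\<beta> \<le> \<alpha> + l * \<epsilon> + (?Q g x - \<alpha>) / \<kappa>" unfolding \<beta>_def by (intro cSUP_least ne)
      then have "\<kappa> * (\<beta> - \<alpha> - l * \<epsilon>) \<le> \<kappa> * ((?Q g x - \<alpha>) / \<kappa>)"
        using \<kappa>(1) by (intro mult_left_mono) auto
      then show ?thesis using \<kappa>(1) by simp
    qed
    have upper: "?Q g x \<le> \<beta>" if x: "x \<in> X" for x
    proof -
      have "(1/2) ^ M * (transfer_op X \<phi> ^^ 0) (\<lambda>x. \<beta> - g x) x \<le> ?Q (\<lambda>x. \<beta> - g x) x"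
        by (rule lazy_op_funpow_ge) (use x \<beta> in auto)
      then have "0 \<le> ?Q (\<lambda>x. \<beta> - g x) x"
        using \<beta>[OF x] by (simp add: order_trans[rotated])
      then show ?thesis using lazy_op_funpow_affine[OF \<phi> x, of M \<beta> "-1" g] by simp
    qed
    define c' where "c' = (1 - \<kappa>) * c + \<kappa> * l * \<epsilon>"
    define l' where "l' = 3/4 * l + 4 * B * c"
    have "osc_lip (?Q g) c ((3/4) ^ M * l + 4 * B * c)"
      by (rule osc_lip_lazy_op_funpow[OF B c l g])
    moreover have "(3/4) ^ M * l \<le> 3/4 * l"
      using l power_decreasing[of 1 M "3/4::real"] by (intro mult_right_mono) (auto simp: M_def)
    ultimately have lip: "\<bar>?Q g x - ?Q g y\<bar> \<le> l' * seq_dist x y" if "x \<in> X" "y \<in> X" "x 0 = y 0" for x y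
      using that mult_right_mono[of "(3/4) ^ M * l + 4 * B * c" l' "seq_dist x y"] seq_dist_nonneg[of x y]
      unfolding osc_lip_def l'_def by fastforce
    have diff: "?Q g y - ?Q g x \<le> c'" if "x \<in> X" "y \<in> X" for x y
    proof -
      have "?Q g y - ?Q g x \<le> (1 - \<kappa>) * (\<beta> - \<alpha>) + \<kappa> * l * \<epsilon>"
        using lower[OF that(1)] upper[OF that(2)] by (simp add: algebra_simps)
      also have "\<dots> \<le> c'"
        unfolding c'_def using width \<kappa>(2) by (intro add_right_mono mult_left_mono) auto
      finally show ?thesis .
    qed
    have "osc_lip (?Q g) c' l'"
      unfolding osc_lip_def using lip diff by (auto simp: abs_le_iff)
    moreover have "c' + t * l' \<le> \<gamma> * (c + t * l)"
    proof -
      have tB: "t * (4 * B) = \<kappa> / 2" "\<kappa> = 8 * B * t" using B(1) by (auto simp: t_def)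
      have "c' + t * l' = (1 - \<kappa>) * c + \<kappa> * l * \<epsilon> + (3/4) * (t * l) + (t * (4 * B)) * c"
        by (simp add: c'_def l'_def algebra_simps)
      also have "\<dots> = (1 - \<kappa> / 2) * c + (8 * B * \<epsilon> + 3/4) * (t * l)"
        unfolding tB(1) by (subst (2) tB(2)) (simp add: algebra_simps)
      also have "\<dots> \<le> \<gamma> * c + \<gamma> * (t * l)"
        using c l \<epsilon> \<kappa> B(1) by (intro add_mono mult_right_mono) (auto simp: \<gamma>_def t_def)
      finally show ?thesis by (simp add: algebra_simps)
    qed
    moreover have "0 \<le> c'" "0 \<le> l'" using c l \<kappa> \<epsilon> B(1) by (auto simp: c'_def l'_def)
    ultimately show "\<exists>c' l'. 0 \<le> c' \<and> 0 \<le> l' \<and> osc_lip (?Q g) c' l' \<and> c' + t * l' \<le> \<gamma> * (c + t * l)"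
      by blast
  qed
qed

lemma osc_lip_bounded_lipschitz:
  assumes "bounded_lipschitz X g"
  obtains c l where "0 \<le> c" "0 \<le> l" "osc_lip g c l"
proof -
  obtain B where B: "B > 0" "\<And>x. x \<in> X \<Longrightarrow> \<bar>g x\<bar> \<le> B"
    "\<And>x y. x \<in> X \<Longrightarrow> y \<in> X \<Longrightarrow> \<bar>g x - g y\<bar> \<le> B * seq_dist x y"
    using assms by (rule bounded_lipschitzE) blast
  have "\<bar>g x - g y\<bar> \<le> 2 * B" if "x \<in> X" "y \<in> X" for x y
    using B(2)[OF that(1)] B(2)[OF that(2)] by linarith
  then show ?thesis using B that[of "2 * B" B] by (simp add: osc_lip_def)
qed

lemma bounded_lipschitz_lazy_op_funpow:
  assumes "bounded_lipschitz X \<phi>" "bounded_lipschitz X g"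
  shows "bounded_lipschitz X ((lazy_op \<phi> ^^ n) g)"
proof (induction n)
  case (Suc n)
  have "bounded_lipschitz X (\<lambda>x. (1/2) * ((lazy_op \<phi> ^^ n) g x + transfer_op X \<phi> ((lazy_op \<phi> ^^ n) g) x))"
    by (intro bounded_lipschitz_mult bounded_lipschitz_add bounded_lipschitz_const
        bounded_lipschitz_transfer_op assms Suc)
  then show ?case by (simp add: lazy_op_def[abs_def])
qed (simp add: assms)

lemma integral_lazy_op_funpow:
  assumes m: "gibbs_measure X \<phi> m" and bl: "bounded_lipschitz X \<phi>" "bounded_lipschitz X g"
  shows "(\<integral>x. (lazy_op \<phi> ^^ n) g x \<partial>m) = (\<integral>x. g x \<partial>m)"
proof (induction n)
  case (Suc n)
  let ?h = "(lazy_op \<phi> ^^ n) g"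
  have h: "bounded_lipschitz X ?h" by (rule bounded_lipschitz_lazy_op_funpow[OF bl])
  have "(\<integral>x. (lazy_op \<phi> ^^ Suc n) g x \<partial>m) = (\<integral>x. (?h x + transfer_op X \<phi> ?h x) / 2 \<partial>m)"
    by (simp add: lazy_op_def)
  also have "\<dots> = ((\<integral>x. ?h x \<partial>m) + (\<integral>x. transfer_op X \<phi> ?h x \<partial>m)) / 2"
    by (subst Bochner_Integration.integral_divide_zero, subst Bochner_Integration.integral_add)
      (auto intro!: integrable_gibbs[OF m] h bounded_lipschitz_transfer_op bl)
  finally show ?case using Suc integral_transfer_op[OF m h] by simp
qed simp

text \<open>The lazy operator preserves the integral, and the oscillation of its iterates tends to 0. In
  particular the Gibbs measure of a normalized potential is unique.\<close>

theorem lazy_op_funpow_tendsto_integral: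
  assumes \<phi>: "\<phi> \<in> normalized_potentials X" and m: "gibbs_measure X \<phi> m"
    and g: "bounded_lipschitz X g" and x: "x \<in> X"
  shows "(\<lambda>n. (lazy_op \<phi> ^^ n) g x) \<longlonglongrightarrow> (\<integral>x. g x \<partial>m)"
proof -
  interpret prob_space m using m by (rule gibbs_measure_props)
  note bl = bounded_lipschitz_potential[OF \<phi>]
  have "X \<noteq> {}" using x by blast
  then obtain M :: nat and t \<gamma> :: real where t: "0 < t" "0 \<le> \<gamma>" "\<gamma> < 1" and
    contr: "\<And>g c l. 0 \<le> c \<Longrightarrow> 0 \<le> l \<Longrightarrow> osc_lip g c l \<Longrightarrow>
       \<exists>c' l'. 0 \<le> c' \<and> 0 \<le> l' \<and> osc_lip ((lazy_op \<phi> ^^ M) g) c' l' \<and> c' + t * l' \<le> \<gamma> * (c + t * l)"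
    by (rule lazy_op_contraction[OF \<phi>]) (rule that; assumption)
  obtain c l where cl: "0 \<le> c" "0 \<le> l" "osc_lip g c l" using osc_lip_bounded_lipschitz[OF g] .
  have iter: "\<exists>c' l'. 0 \<le> c' \<and> 0 \<le> l' \<and> osc_lip ((lazy_op \<phi> ^^ (k * M)) g) c' l' \<and>
      c' + t * l' \<le> \<gamma> ^ k * (c + t * l)" for k
  proof (induction k)
    case 0
    then show ?case using cl by auto
  next
    case (Suc k)
    then obtain c' l' where 1: "0 \<le> c'" "0 \<le> l'" "osc_lip ((lazy_op \<phi> ^^ (k * M)) g) c' l'"
      "c' + t * l' \<le> \<gamma> ^ k * (c + t * l)" by blast
    obtain c'' l'' where 2: "0 \<le> c''" "0 \<le> l''"
      "osc_lip ((lazy_op \<phi> ^^ M) ((lazy_op \<phi> ^^ (k * M)) g)) c'' l''"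
      "c'' + t * l'' \<le> \<gamma> * (c' + t * l')" using contr[OF 1(1-3)] by blast
    have "\<gamma> * (c' + t * l') \<le> \<gamma> * (\<gamma> ^ k * (c + t * l))" using 1(4) t(2) by (rule mult_left_mono)
    then have "c'' + t * l'' \<le> \<gamma> ^ Suc k * (c + t * l)" using 2(4) by (simp add: mult_ac)
    moreover have "(lazy_op \<phi> ^^ M) ((lazy_op \<phi> ^^ (k * M)) g) = (lazy_op \<phi> ^^ (Suc k * M)) g"
      by (simp add: funpow_add)
    ultimately show ?case using 2 by metis
  qed
  show ?thesis
  proof (rule LIMSEQ_I)
    fix e :: real assume e: "0 < e"
    have "(\<lambda>k. \<gamma> ^ k * (c + t * l)) \<longlonglongrightarrow> 0 * (c + t * l)"
      using t by (intro tendsto_mult_right LIMSEQ_power_zero) auto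
    then have "\<forall>\<^sub>F k in sequentially. \<gamma> ^ k * (c + t * l) < e"
      using e by (intro order_tendstoD) auto
    then obtain k where k: "\<gamma> ^ k * (c + t * l) < e" by (auto simp: eventually_sequentially)
    obtain c' l' where c': "0 \<le> c'" "0 \<le> l'" "osc_lip ((lazy_op \<phi> ^^ (k * M)) g) c' l'"
      "c' + t * l' \<le> \<gamma> ^ k * (c + t * l)" using iter by blast
    have "c' < e" using c' k t(1) mult_nonneg_nonneg[of t l'] by linarith
    show "\<exists>n0. \<forall>n\<ge>n0. norm ((lazy_op \<phi> ^^ n) g x - (\<integral>x. g x \<partial>m)) < e"
    proof (intro exI allI impI)
      fix n assume n: "k * M \<le> n"
      obtain B where B: "B > 0"
        "\<And>g c l. 0 \<le> l \<Longrightarrow> osc_lip g c l \<Longrightarrow> osc_lip (lazy_op \<phi> g) c (3/4 * l + B * c)"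
        using osc_lip_lazy_op[OF \<phi>] by blast
      let ?h = "(lazy_op \<phi> ^^ n) g"
      have "?h = (lazy_op \<phi> ^^ (n - k * M)) ((lazy_op \<phi> ^^ (k * M)) g)"
        using n by (metis comp_apply funpow_add le_add_diff_inverse2)
      then have osc: "\<bar>?h y - ?h x\<bar> \<le> c'" if "y \<in> X" for y
        using osc_lip_lazy_op_funpow[OF B c'(1-3), of "n - k * M"] x that by (simp add: osc_lip_def)
      have int: "integrable m ?h"
        by (intro integrable_gibbs[OF m] bounded_lipschitz_lazy_op_funpow bl g)
      have "AE y in m. ?h y \<le> ?h x + c'" "AE y in m. ?h x - c' \<le> ?h y"
        using osc gibbs_measure_props(2)[OF m] by (auto intro!: AE_I2 simp: abs_le_iff algebra_simps)
      then have "(\<integral>y. ?h y \<partial>m) \<le> ?h x + c'" "?h x - c' \<le> (\<integral>y. ?h y \<partial>m)"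
        using integral_le_const[OF int] integral_ge_const[OF int] by auto
      then show "norm (?h x - (\<integral>x. g x \<partial>m)) < e"
        using \<open>c' < e\<close> integral_lazy_op_funpow[OF m bl g, of n] by simp
    qed
  qed
qed

end

section \<open>Concentration of the posterior\<close>

text \<open>The density of the prior is replaced by what the argument uses of it, the positive mass of the balls
  around the true parameter. The parameter space may then be any compact metric space.\<close>

locale gibbs_family = transitive_subshift +
  fixes T :: "'p::metric_space set" and f :: "'p \<Rightarrow> (nat \<Rightarrow> nat) \<Rightarrow> real"
    and \<mu> :: "'p \<Rightarrow> (nat \<Rightarrow> nat) measure" and \<nu> :: "'p measure" and \<theta>\<^sub>0 :: 'p
  assumes compact_T: "compact T"
    and potentials: "f \<in> T \<rightarrow> normalized_potentials X"
    and embedding: "embedding_map (top_of_set T) (mtopology_of (potential_metric X)) f"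
    and gibbs: "\<And>\<theta>. \<theta> \<in> T \<Longrightarrow> gibbs_measure X (f \<theta>) (\<mu> \<theta>)"
    and prob_prior: "prob_space \<nu>"
    and sets_prior: "sets \<nu> = sets (restrict_space borel T)"
    and prior_ball_pos: "\<And>d. 0 < d \<Longrightarrow> 0 < measure \<nu> {\<theta> \<in> T. dist \<theta> \<theta>\<^sub>0 < d}"
    and true_parameter: "\<theta>\<^sub>0 \<in> T"
begin

lemma potential: "\<theta> \<in> T \<Longrightarrow> f \<theta> \<in> normalized_potentials X"
  using potentials by blast

lemma bounded_lipschitz_f: "\<theta> \<in> T \<Longrightarrow> bounded_lipschitz X (f \<theta>)"
  by (intro bounded_lipschitz_potential potential)

lemma nonempty: "X \<noteq> {}"
  using prob_space.not_empty[OF gibbs_measure_props(1)[OF gibbs[OF true_parameter]]]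
    gibbs_measure_props(2)[OF gibbs[OF true_parameter]] by simp

lemma space_prior: "space \<nu> = T"
  using sets_eq_imp_space_eq[OF sets_prior] by (simp add: space_restrict_space)

text \<open>The topology on potentials comes from the Lipschitz norm, which dominates the sup norm.\<close>

lemma potential_sup_close:
  assumes \<theta>1: "\<theta>1 \<in> T" and \<eta>: "0 < \<eta>"
  obtains d where "0 < d" "\<And>\<theta> x. \<theta> \<in> T \<Longrightarrow> dist \<theta> \<theta>1 < d \<Longrightarrow> x \<in> X \<Longrightarrow> \<bar>f \<theta> x - f \<theta>1 x\<bar> \<le> \<eta>"
proof -
  interpret M: Metric_space "normalized_potentials X" "potential_dist X"
    by (rule Metric_space_potential_dist[OF nonempty])
  have top: "mtopology_of (potential_metric X) = M.mtopology"
    by (simp add: mtopology_of_def nonempty)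
  have cont: "continuous_map (top_of_set T) M.mtopology f"
    using embedding unfolding embedding_map_def top
    by (auto dest: homeomorphic_imp_continuous_map simp: continuous_map_in_subtopology)
  define U where "U = {\<theta> \<in> topspace (top_of_set T). f \<theta> \<in> M.mball (f \<theta>1) \<eta>}"
  have "openin (top_of_set T) U"
    unfolding U_def by (rule openin_continuous_map_preimage[OF cont M.openin_mball])
  moreover have "\<theta>1 \<in> U" using \<theta>1 \<eta> potential by (simp add: U_def)
  ultimately obtain d where d: "0 < d" "\<forall>\<theta>\<in>T. dist \<theta> \<theta>1 < d \<longrightarrow> \<theta> \<in> U"
    unfolding openin_euclidean_subtopology_iff by blast
  show ?thesis
  proof (rule that[OF d(1)])
    fix \<theta> x assume \<theta>: "\<theta> \<in> T" "dist \<theta> \<theta>1 < d" and x: "x \<in> X"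
    note np = potential[OF \<theta>1] potential[OF \<theta>(1)]
    note bdd = lip_norm_bdd[OF nonempty np]
    have "potential_dist X (f \<theta>1) (f \<theta>) < \<eta>" using d(2) \<theta> by (simp add: U_def)
    then have "lip_norm X (\<lambda>x. f \<theta>1 x - f \<theta> x) < \<eta>" using np by (simp add: potential_dist_def)
    moreover have "\<bar>f \<theta>1 x - f \<theta> x\<bar> \<le> (SUP x\<in>X. \<bar>f \<theta>1 x - f \<theta> x\<bar>)"
      by (rule cSUP_upper[OF x bdd(1)])
    moreover have "0 \<le> (SUP (x, y)\<in>X \<times> X. \<bar>(f \<theta>1 x - f \<theta> x) - (f \<theta>1 y - f \<theta> y)\<bar> / seq_dist x y)"
      by (rule cSUP_upper2[OF bdd(2), of "(x, x)"]) (use x in auto)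
    ultimately show "\<bar>f \<theta> x - f \<theta>1 x\<bar> \<le> \<eta>"
      unfolding lip_norm_def by (simp add: abs_minus_commute)
  qed
qed

lemma potentials_differ:
  assumes "\<theta> \<in> T" "\<theta> \<noteq> \<theta>\<^sub>0"
  obtains z where "z \<in> X" "f \<theta>\<^sub>0 z \<noteq> f \<theta> z"
proof -
  have "inj_on f T"
    using embedding unfolding embedding_map_def by (auto dest: homeomorphic_imp_injective_map)
  then have "f \<theta> \<noteq> f \<theta>\<^sub>0" using assms true_parameter by (auto dest: inj_onD)
  moreover have "f \<theta> \<in> extensional X" "f \<theta>\<^sub>0 \<in> extensional X"
    using potential assms(1) true_parameter by (auto simp: normalized_potentials_def)
  ultimately have "\<exists>z\<in>X. f \<theta>\<^sub>0 z \<noteq> f \<theta> z" by (metis extensionalityI)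
  then show ?thesis using that by blast
qed

lemma continuous_on_potential: "x \<in> X \<Longrightarrow> continuous_on T (\<lambda>\<theta>. f \<theta> x)"
  unfolding continuous_on_iff
proof (intro ballI allI impI)
  fix \<theta>1 and e :: real assume x: "x \<in> X" and "\<theta>1 \<in> T" "0 < e"
  then obtain d where "0 < d" "\<And>\<theta> x. \<theta> \<in> T \<Longrightarrow> dist \<theta> \<theta>1 < d \<Longrightarrow> x \<in> X \<Longrightarrow> \<bar>f \<theta> x - f \<theta>1 x\<bar> \<le> e / 2"
    using potential_sup_close[of \<theta>1 "e / 2"] by (metis half_gt_zero)
  then show "\<exists>d>0. \<forall>\<theta>\<in>T. dist \<theta> \<theta>1 < d \<longrightarrow> dist (f \<theta> x) (f \<theta>1 x) < e"
    using x \<open>0 < e\<close> by (intro exI[of _ d]) (fastforce simp: dist_real_def)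
qed

lemma continuous_on_lazy_op_funpow:
  "x \<in> X \<Longrightarrow> continuous_on T (\<lambda>\<theta>. (lazy_op (f \<theta>) ^^ n) g x)"
proof (induction n arbitrary: x)
  case (Suc n)
  show ?case
    unfolding lazy_op_funpow_Suc transfer_op_def
    by (intro continuous_intros Suc continuous_on_potential) auto
qed simp

text \<open>The likelihood is a pointwise limit of functions that are continuous in the parameter.\<close>

lemma measurable_cylinder_likelihood [measurable]:
  "(\<lambda>\<theta>. measure (\<mu> \<theta>) (cylinder X n y)) \<in> borel_measurable \<nu>"
proof -
  obtain x where x: "x \<in> X" using nonempty by blast
  show ?thesis
  proof (rule borel_measurable_LIMSEQ_real)
    fix \<theta> assume "\<theta> \<in> space \<nu>"
    then have \<theta>: "\<theta> \<in> T" by (simp add: space_prior)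
    show "(\<lambda>i. (lazy_op (f \<theta>) ^^ i) (indicator (cylinder X n y)) x) \<longlonglongrightarrow> measure (\<mu> \<theta>) (cylinder X n y)"
      unfolding measure_cylinder_eq_integral[OF gibbs[OF \<theta>]]
      by (intro lazy_op_funpow_tendsto_integral potential gibbs bounded_lipschitz_cylinder \<theta> x)
  next
    fix i
    have "(\<lambda>\<theta>. (lazy_op (f \<theta>) ^^ i) (indicator (cylinder X n y)) x) \<in> borel_measurable (restrict_space borel T)"
      by (intro borel_measurable_continuous_on_restrict continuous_on_lazy_op_funpow x)
    then show "(\<lambda>\<theta>. (lazy_op (f \<theta>) ^^ i) (indicator (cylinder X n y)) x) \<in> borel_measurable \<nu>"
      by (simp cong: measurable_cong_sets add: sets_prior)
  qed
qed

lemma likelihood_le_one: "\<theta> \<in> T \<Longrightarrow> measure (\<mu> \<theta>) C \<le> 1"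
  using gibbs_measure_props(1)[OF gibbs] by (rule prob_space.prob_le_1)

lemma integrable_likelihood: "integrable \<nu> (\<lambda>\<theta>. measure (\<mu> \<theta>) (cylinder X n y))"
proof -
  interpret prob_space \<nu> by (rule prob_prior)
  show ?thesis
    by (rule integrable_const_bound[of _ 1]) (auto simp: space_prior likelihood_le_one)
qed

lemma ball_in_sets: "{\<theta> \<in> T. dist \<theta> \<theta>\<^sub>0 < \<delta>} \<in> sets \<nu>"
proof -
  have "{\<theta> \<in> T. dist \<theta> \<theta>\<^sub>0 < \<delta>} = T \<inter> ball \<theta>\<^sub>0 \<delta>" by (auto simp: dist_commute)
  then show ?thesis by (simp add: sets_prior sets_restrict_space)
qed

definition evidence :: "nat \<Rightarrow> (nat \<Rightarrow> nat) \<Rightarrow> real" where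
  "evidence n y = (\<integral>\<theta>. measure (\<mu> \<theta>) (cylinder X n y) \<partial>\<nu>)"

text \<open>Only the parameters near the true one are kept. The constant \<open>K\<close> is independent of \<open>n\<close> and \<open>y\<close> because
  the bounds on cylinders hold uniformly for potentials in a sup-norm ball.\<close>

lemma evidence_lower_bound:
  assumes \<eta>: "0 < \<eta>"
  obtains K :: real where "0 < K" "\<And>n y. y \<in> X \<Longrightarrow> K * exp (birkhoff_sum (f \<theta>\<^sub>0) n y - \<eta> * real n) \<le> evidence n y"
proof -
  interpret prob_space \<nu> by (rule prob_prior)
  obtain B where B: "B > 0" "\<And>x. x \<in> X \<Longrightarrow> \<bar>f \<theta>\<^sub>0 x\<bar> \<le> B"
    "\<And>x y. x \<in> X \<Longrightarrow> y \<in> X \<Longrightarrow> \<bar>f \<theta>\<^sub>0 x - f \<theta>\<^sub>0 y\<bar> \<le> B * seq_dist x y"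
    using bounded_lipschitz_f[OF true_parameter] by (rule bounded_lipschitzE) blast
  obtain d where d: "0 < d" "\<And>\<theta> x. \<theta> \<in> T \<Longrightarrow> dist \<theta> \<theta>\<^sub>0 < d \<Longrightarrow> x \<in> X \<Longrightarrow> \<bar>f \<theta> x - f \<theta>\<^sub>0 x\<bar> \<le> \<eta>"
    using potential_sup_close[OF true_parameter \<eta>] by blast
  obtain M :: nat where M: "\<And>\<phi> m z (B::real). gibbs_measure X \<phi> m \<Longrightarrow> bounded_lipschitz X \<phi> \<Longrightarrow>
      (\<forall>x\<in>X. \<bar>\<phi> x\<bar> \<le> B) \<Longrightarrow> z \<in> X \<Longrightarrow> exp (- (real M * B)) / (real M + 1) \<le> measure m (cylinder X 1 z)"
    using symbol_measure_ge by blast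
  define \<kappa> where "\<kappa> = exp (- (real M * (B + \<eta>))) / (real M + 1)"
  have \<kappa>: "0 < \<kappa>" by (simp add: \<kappa>_def)
  define S where "S = {\<theta> \<in> T. dist \<theta> \<theta>\<^sub>0 < d}"
  have S: "S \<in> sets \<nu>" "0 < measure \<nu> S"
    unfolding S_def by (rule ball_in_sets, rule prior_ball_pos[OF d(1)])
  show ?thesis
  proof (rule that[of "measure \<nu> S * (\<kappa> * exp (- B))"])
    show "0 < measure \<nu> S * (\<kappa> * exp (- B))" using S \<kappa> by simp
    fix n y assume y: "y \<in> X"
    define V where "V = \<kappa> * exp (- B) * exp (birkhoff_sum (f \<theta>\<^sub>0) n y - \<eta> * real n)"
    have V: "V \<le> measure (\<mu> \<theta>) (cylinder X n y)" if "\<theta> \<in> S" for \<theta>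
    proof -
      have \<theta>: "\<theta> \<in> T" "dist \<theta> \<theta>\<^sub>0 < d" using that by (auto simp: S_def)
      have "\<bar>f \<theta> x\<bar> \<le> B + \<eta>" if "x \<in> X" for x using d(2)[OF \<theta> that] B(2)[OF that] by linarith
      then have "\<kappa> \<le> measure (\<mu> \<theta>) (cylinder X 1 ((shift ^^ n) y))"
        unfolding \<kappa>_def by (intro M[OF gibbs bounded_lipschitz_f] \<theta> shift_funpow_in y) auto
      then have "exp (birkhoff_sum (f \<theta>\<^sub>0) n y - B - n * \<eta>) * \<kappa>
          \<le> exp (birkhoff_sum (f \<theta>\<^sub>0) n y - B - n * \<eta>) * measure (\<mu> \<theta>) (cylinder X 1 ((shift ^^ n) y))"
        by (rule mult_left_mono) simp
      also have "\<dots> \<le> measure (\<mu> \<theta>) (cylinder X n y)"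
        by (rule measure_cylinder_ge[OF gibbs bounded_lipschitz_f d(2) B(3) _ y])
          (use \<theta> B(1) in auto)
      finally show ?thesis
        unfolding V_def mult.assoc mult_exp_exp by (simp add: algebra_simps)
    qed
    have "measure \<nu> S * V = (\<integral>\<theta>. indicator S \<theta> * V \<partial>\<nu>)"
      using S(1) sets.sets_into_space[OF S(1)] by (simp add: Int_absorb1)
    also have "\<dots> \<le> evidence n y"
      unfolding evidence_def
    proof (rule integral_mono[OF _ integrable_likelihood])
      show "integrable \<nu> (\<lambda>\<theta>. indicator S \<theta> * V)"
        using S(1) by (intro integrable_mult_left integrable_real_indicator) (auto simp: emeasure_eq_measure)
      show "indicator S \<theta> * V \<le> measure (\<mu> \<theta>) (cylinder X n y)" for \<theta>
        using V by (simp add: indicator_def)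
    qed
    finally show "measure \<nu> S * (\<kappa> * exp (- B)) * exp (birkhoff_sum (f \<theta>\<^sub>0) n y - \<eta> * real n) \<le> evidence n y"
      by (simp add: V_def mult.assoc)
  qed
qed

lemma evidence_pos:
  assumes "y \<in> X"
  shows "0 < evidence n y"
proof -
  obtain K :: real where "0 < K" "\<And>n y. y \<in> X \<Longrightarrow> K * exp (birkhoff_sum (f \<theta>\<^sub>0) n y - 1 * real n) \<le> evidence n y"
    using evidence_lower_bound[of 1] by auto
  then show ?thesis using assms by (meson exp_gt_zero less_le_trans mult_pos_pos)
qed

text \<open>The radius \<open>d\<close> is chosen so that replacing \<open>f \<theta>\<close> by \<open>f \<theta>1\<close> costs half of the exponential gap
  between \<open>f \<theta>1\<close> and the true potential.\<close>

lemma likelihood_upper_bound_near: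
  assumes \<theta>1: "\<theta>1 \<in> T" "\<theta>1 \<noteq> \<theta>\<^sub>0"
  shows "\<exists>d c K :: real. 0 < d \<and> 0 < c \<and> (AE y in \<mu> \<theta>\<^sub>0. \<forall>\<^sub>F n in sequentially. \<forall>\<theta>\<in>T. dist \<theta> \<theta>1 < d \<longrightarrow>
    measure (\<mu> \<theta>) (cylinder X n y) \<le> K * exp (birkhoff_sum (f \<theta>\<^sub>0) n y - c * real n))"
proof -
  obtain z where z: "z \<in> X" "f \<theta>\<^sub>0 z \<noteq> f \<theta>1 z" using potentials_differ[OF \<theta>1] .
  obtain c where c: "0 < c" and gap: "AE y in \<mu> \<theta>\<^sub>0. \<forall>\<^sub>F n in sequentially.
      birkhoff_sum (f \<theta>1) n y \<le> birkhoff_sum (f \<theta>\<^sub>0) n y - c * real n"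
    using AE_birkhoff_sum_gap[where \<phi> = "f \<theta>\<^sub>0" and \<xi> = "f \<theta>1",
        OF potential[OF true_parameter] potential[OF \<theta>1(1)] z gibbs[OF true_parameter]] by blast
  obtain B where B: "B > 0"
    "\<And>x y. x \<in> X \<Longrightarrow> y \<in> X \<Longrightarrow> \<bar>f \<theta>1 x - f \<theta>1 y\<bar> \<le> B * seq_dist x y"
    using bounded_lipschitz_f[OF \<theta>1(1)] by (rule bounded_lipschitzE) blast
  obtain d where d: "0 < d" "\<And>\<theta> x. \<theta> \<in> T \<Longrightarrow> dist \<theta> \<theta>1 < d \<Longrightarrow> x \<in> X \<Longrightarrow> \<bar>f \<theta> x - f \<theta>1 x\<bar> \<le> c / 2"
    using potential_sup_close[OF \<theta>1(1), of "c / 2"] c by (metis half_gt_zero)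
  have "AE y in \<mu> \<theta>\<^sub>0. \<forall>\<^sub>F n in sequentially. \<forall>\<theta>\<in>T. dist \<theta> \<theta>1 < d \<longrightarrow>
    measure (\<mu> \<theta>) (cylinder X n y) \<le> exp B * exp (birkhoff_sum (f \<theta>\<^sub>0) n y - c / 2 * real n)"
    using gap AE_space
  proof eventually_elim
    case (elim y)
    then have y: "y \<in> X" using gibbs_measure_props(2)[OF gibbs[OF true_parameter]] by simp
    from elim(1) show ?case
    proof eventually_elim
      case (elim n)
      show ?case
      proof (intro ballI impI)
        fix \<theta> assume \<theta>: "\<theta> \<in> T" "dist \<theta> \<theta>1 < d"
        have "measure (\<mu> \<theta>) (cylinder X n y) \<le> exp (birkhoff_sum (f \<theta>1) n y + B + n * (c / 2))"
          by (rule measure_cylinder_le[OF gibbs bounded_lipschitz_f d(2) B(2) _ y])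
            (use \<theta> B(1) in auto)
        also have "\<dots> \<le> exp (B + (birkhoff_sum (f \<theta>\<^sub>0) n y - c / 2 * real n))"
          using elim by (simp add: algebra_simps)
        finally show "measure (\<mu> \<theta>) (cylinder X n y) \<le> exp B * exp (birkhoff_sum (f \<theta>\<^sub>0) n y - c / 2 * real n)"
          by (simp add: exp_add)
      qed
    qed
  qed
  then show ?thesis using d(1) c by (intro exI[of _ d] exI[of _ "c / 2"] exI[of _ "exp B"]) simp
qed

text \<open>The parameters at distance at least \<open>\<delta>\<close> from the true one form a compact set, covered by finitely
  many of the neighbourhoods of the preceding lemma. The exceptional null sets are then finitely many
  as well.\<close>

lemma likelihood_upper_bound:
  assumes \<delta>: "0 < \<delta>"
  shows "\<exists>c K :: real. 0 < c \<and> 0 < K \<and> (AE y in \<mu> \<theta>\<^sub>0. \<forall>\<^sub>F n in sequentially. \<forall>\<theta>\<in>T. \<delta> \<le> dist \<theta> \<theta>\<^sub>0 \<longrightarrow>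
    measure (\<mu> \<theta>) (cylinder X n y) \<le> K * exp (birkhoff_sum (f \<theta>\<^sub>0) n y - c * real n))"
proof -
  define F where "F = T - ball \<theta>\<^sub>0 \<delta>"
  have F: "compact F" unfolding F_def using compact_T by (rule compact_diff) simp
  have "\<forall>\<theta>1\<in>F. \<exists>p :: real \<times> real \<times> real. 0 < fst p \<and> 0 < fst (snd p) \<and> (AE y in \<mu> \<theta>\<^sub>0. \<forall>\<^sub>F n in sequentially.
    \<forall>\<theta>\<in>T. dist \<theta> \<theta>1 < fst p \<longrightarrow>
    measure (\<mu> \<theta>) (cylinder X n y) \<le> snd (snd p) * exp (birkhoff_sum (f \<theta>\<^sub>0) n y - fst (snd p) * real n))"
  proof
    fix \<theta>1 assume "\<theta>1 \<in> F"
    then have "\<theta>1 \<in> T" "\<theta>1 \<noteq> \<theta>\<^sub>0" using \<delta> by (auto simp: F_def)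
    from likelihood_upper_bound_near[OF this] show "\<exists>p :: real \<times> real \<times> real. 0 < fst p \<and> 0 < fst (snd p) \<and>
      (AE y in \<mu> \<theta>\<^sub>0. \<forall>\<^sub>F n in sequentially. \<forall>\<theta>\<in>T. dist \<theta> \<theta>1 < fst p \<longrightarrow>
      measure (\<mu> \<theta>) (cylinder X n y) \<le> snd (snd p) * exp (birkhoff_sum (f \<theta>\<^sub>0) n y - fst (snd p) * real n))"
      by (simp add: split_paired_Ex)
  qed
  from bchoice[OF this] obtain p where p: "\<And>\<theta>1. \<theta>1 \<in> F \<Longrightarrow> 0 < fst (p \<theta>1)"
      "\<And>\<theta>1. \<theta>1 \<in> F \<Longrightarrow> 0 < fst (snd (p \<theta>1))"
      "\<And>\<theta>1. \<theta>1 \<in> F \<Longrightarrow> AE y in \<mu> \<theta>\<^sub>0. \<forall>\<^sub>F n in sequentially. \<forall>\<theta>\<in>T. dist \<theta> \<theta>1 < fst (p \<theta>1) \<longrightarrow>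
    measure (\<mu> \<theta>) (cylinder X n y) \<le> snd (snd (p \<theta>1)) * exp (birkhoff_sum (f \<theta>\<^sub>0) n y - fst (snd (p \<theta>1)) * real n)"
    by blast
  have "F \<subseteq> (\<Union>\<theta>1\<in>F. ball \<theta>1 (fst (p \<theta>1)))" using p(1) by force
  then obtain G where G: "G \<subseteq> F" "finite G" "F \<subseteq> (\<Union>\<theta>1\<in>G. ball \<theta>1 (fst (p \<theta>1)))"
    by (rule compactE_image[OF F, rotated]) auto
  \<comment> \<open>The inserted 1 covers the case that no parameter is at distance \<open>\<delta>\<close> or more.\<close>
  define c where "c = Min (insert 1 ((\<lambda>\<theta>1. fst (snd (p \<theta>1))) ` G))"
  define K where "K = Max (insert 1 ((\<lambda>\<theta>1. snd (snd (p \<theta>1))) ` G))"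
  have c: "0 < c" "\<And>\<theta>1. \<theta>1 \<in> G \<Longrightarrow> c \<le> fst (snd (p \<theta>1))"
    unfolding c_def using G p(2) by auto
  have "1 \<le> K" and K: "\<And>\<theta>1. \<theta>1 \<in> G \<Longrightarrow> snd (snd (p \<theta>1)) \<le> K"
    unfolding K_def using G(2) by (auto intro: Max_ge)
  have "AE y in \<mu> \<theta>\<^sub>0. \<forall>\<theta>1\<in>G. \<forall>\<^sub>F n in sequentially. \<forall>\<theta>\<in>T. dist \<theta> \<theta>1 < fst (p \<theta>1) \<longrightarrow>
    measure (\<mu> \<theta>) (cylinder X n y) \<le> snd (snd (p \<theta>1)) * exp (birkhoff_sum (f \<theta>\<^sub>0) n y - fst (snd (p \<theta>1)) * real n)"
    by (rule AE_finite_allI[OF G(2)]) (use G(1) p(3) in blast)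
  then have "AE y in \<mu> \<theta>\<^sub>0. \<forall>\<^sub>F n in sequentially. \<forall>\<theta>\<in>T. \<delta> \<le> dist \<theta> \<theta>\<^sub>0 \<longrightarrow>
    measure (\<mu> \<theta>) (cylinder X n y) \<le> K * exp (birkhoff_sum (f \<theta>\<^sub>0) n y - c * real n)"
  proof eventually_elim
    case (elim y)
    from eventually_ball_finite[OF G(2) elim] show ?case
    proof eventually_elim
      case (elim n)
      show ?case
      proof (intro ballI impI)
        fix \<theta> assume \<theta>: "\<theta> \<in> T" "\<delta> \<le> dist \<theta> \<theta>\<^sub>0"
        then have "\<theta> \<in> F" by (auto simp: F_def dist_commute)
        then obtain \<theta>1 where \<theta>1: "\<theta>1 \<in> G" "dist \<theta> \<theta>1 < fst (p \<theta>1)"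
          using G(3) by (auto simp: dist_commute)
        have "measure (\<mu> \<theta>) (cylinder X n y) \<le>
          snd (snd (p \<theta>1)) * exp (birkhoff_sum (f \<theta>\<^sub>0) n y - fst (snd (p \<theta>1)) * real n)"
          using elim \<theta>1 \<theta>(1) by blast
        also have "\<dots> \<le> K * exp (birkhoff_sum (f \<theta>\<^sub>0) n y - c * real n)"
          using K[OF \<theta>1(1)] c(2)[OF \<theta>1(1)] \<open>1 \<le> K\<close>
          by (intro mult_mono) (auto intro!: mult_right_mono)
        finally show "measure (\<mu> \<theta>) (cylinder X n y) \<le> K * exp (birkhoff_sum (f \<theta>\<^sub>0) n y - c * real n)" .
      qed
    qed
  qed
  moreover have "0 < K" using \<open>1 \<le> K\<close> by linarith
  ultimately show ?thesis using c(1) by blast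
qed

abbreviation post :: "nat \<Rightarrow> (nat \<Rightarrow> nat) \<Rightarrow> 'p measure" where
  "post n y \<equiv> posterior X \<mu> \<nu> n y"

lemma measure_post:
  assumes "E \<in> sets \<nu>"
  shows "measure (post n y) E = (LINT \<theta>:E|\<nu>. measure (\<mu> \<theta>) (cylinder X n y)) / evidence n y"
  unfolding evidence_def
  by (rule measure_posterior[OF prob_prior _ measurable_cylinder_likelihood assms])
    (auto simp: space_prior intro: gibbs_measure_props gibbs)

lemma sets_post [simp]: "sets (post n y) = sets \<nu>"
  by (simp add: posterior_def)

lemma space_post: "space (post n y) = T"
  by (simp add: posterior_def space_prior)

lemma prob_space_post:
  assumes "y \<in> X"
  shows "prob_space (post n y)"
proof
  have "measure (post n y) (space \<nu>) = 1"
    using evidence_pos[OF assms, of n] unfolding measure_post[OF sets.top]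
    by (simp add: set_integral_space integrable_likelihood evidence_def)
  then show "emeasure (post n y) (space (post n y)) = 1"
    unfolding space_post space_prior measure_def
    by (metis enn2real_eq_posreal_iff ennreal_1 zero_less_one)
qed

lemma measure_post_compl:
  assumes y: "y \<in> X" and E: "E \<in> sets \<nu>"
    and K: "\<And>\<theta>. \<theta> \<in> T - E \<Longrightarrow> measure (\<mu> \<theta>) (cylinder X n y) \<le> K" "0 \<le> K"
  shows "\<bar>measure (post n y) E - 1\<bar> \<le> K / evidence n y"
proof -
  interpret P: prob_space "post n y" by (rule prob_space_post[OF y])
  interpret prob_space \<nu> by (rule prob_prior)
  have E': "space \<nu> - E \<in> sets \<nu>" using E by auto
  have "\<bar>measure (post n y) E - 1\<bar> = measure (post n y) (space \<nu> - E)"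
    using P.prob_compl[of E] E by (simp add: space_post space_prior)
  also have "\<dots> \<le> K / evidence n y"
    unfolding measure_post[OF E']
  proof (rule divide_right_mono)
    have "(LINT \<theta>:space \<nu> - E|\<nu>. measure (\<mu> \<theta>) (cylinder X n y)) \<le> (\<integral>\<theta>. K \<partial>\<nu>)"
      unfolding set_lebesgue_integral_def
    proof (rule integral_mono)
      show "integrable \<nu> (\<lambda>\<theta>. indicator (space \<nu> - E) \<theta> *\<^sub>R measure (\<mu> \<theta>) (cylinder X n y))"
        by (rule integrable_mult_indicator[OF E' integrable_likelihood])
    qed (use K in \<open>auto simp: indicator_def space_prior\<close>)
    then show "(LINT \<theta>:space \<nu> - E|\<nu>. measure (\<mu> \<theta>) (cylinder X n y)) \<le> K"
      by (simp add: prob_space)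
    show "0 \<le> evidence n y" using evidence_pos[OF y, of n] by simp
  qed
  finally show ?thesis .
qed

text \<open>The numerator decays at rate \<open>c\<close> relative to \<open>exp (birkhoff_sum (f \<theta>\<^sub>0) n y)\<close>, the denominator at rate at
  most \<open>c / 2\<close>. Of the remaining rate \<open>c / 2\<close>, one half absorbs the constant factor.\<close>

theorem posterior_concentrates:
  assumes \<delta>: "0 < \<delta>"
  shows "\<exists>c>0. AE y in \<mu> \<theta>\<^sub>0. \<forall>\<^sub>F n in sequentially.
    \<bar>measure (post n y) {\<theta> \<in> T. dist \<theta> \<theta>\<^sub>0 < \<delta>} - 1\<bar> \<le> exp (- c * real n)"
proof -
  obtain c K where c: "0 < c" and K: "0 < K" and upper: "AE y in \<mu> \<theta>\<^sub>0. \<forall>\<^sub>F n in sequentially. \<forall>\<theta>\<in>T.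
    \<delta> \<le> dist \<theta> \<theta>\<^sub>0 \<longrightarrow> measure (\<mu> \<theta>) (cylinder X n y) \<le> K * exp (birkhoff_sum (f \<theta>\<^sub>0) n y - c * real n)"
    using likelihood_upper_bound[OF \<delta>] by blast
  obtain L where L: "0 < L" "\<And>n y. y \<in> X \<Longrightarrow> L * exp (birkhoff_sum (f \<theta>\<^sub>0) n y - c / 2 * real n) \<le> evidence n y"
    using evidence_lower_bound[of "c / 2"] c by (metis half_gt_zero)
  have "(\<lambda>n. K / L * exp (- c / 4) ^ n) \<longlonglongrightarrow> K / L * 0"
    using c by (intro tendsto_mult_left LIMSEQ_power_zero) auto
  then have ev: "\<forall>\<^sub>F n in sequentially. K / L * exp (- c / 4) ^ n < 1"
    by (intro order_tendstoD) auto
  have "AE y in \<mu> \<theta>\<^sub>0. \<forall>\<^sub>F n in sequentially.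
    \<bar>measure (post n y) {\<theta> \<in> T. dist \<theta> \<theta>\<^sub>0 < \<delta>} - 1\<bar> \<le> exp (- (c / 4) * real n)"
    using upper AE_space
  proof eventually_elim
    case (elim y)
    then have y: "y \<in> X" using gibbs_measure_props(2)[OF gibbs[OF true_parameter]] by simp
    from elim(1) ev show ?case
    proof eventually_elim
      case (elim n)
      let ?S = "birkhoff_sum (f \<theta>\<^sub>0) n y"
      have "\<bar>measure (post n y) {\<theta> \<in> T. dist \<theta> \<theta>\<^sub>0 < \<delta>} - 1\<bar> \<le> K * exp (?S - c * real n) / evidence n y"
        by (rule measure_post_compl[OF y ball_in_sets]) (use elim(1) K in auto)
      also have "\<dots> \<le> K * exp (?S - c * real n) / (L * exp (?S - c / 2 * real n))"
        using L K y by (intro divide_left_mono) (auto intro!: mult_pos_pos evidence_pos)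
      also have "\<dots> = K / L * exp ((?S - c * real n) - (?S - c / 2 * real n))"
        by (simp only: exp_diff times_divide_times_eq)
      also have "(?S - c * real n) - (?S - c / 2 * real n) = real n * (- c / 4) + - (c / 4) * real n"
        by (simp add: algebra_simps)
      also have "K / L * exp (real n * (- c / 4) + - (c / 4) * real n) =
          (K / L * exp (- c / 4) ^ n) * exp (- (c / 4) * real n)"
        by (simp only: exp_add exp_of_nat_mult mult.assoc)
      also have "\<dots> \<le> 1 * exp (- (c / 4) * real n)"
        using elim(2) by (intro mult_right_mono) auto
      finally show ?case by simp
    qed
  qed
  with c show ?thesis by (intro exI[of _ "c / 4"]) simp
qed

text \<open>Countably many radii suffice, so the exceptional sets add up to a null set that depends neither
  on the radius nor on the test function.\<close>

theorem posterior_weak_star: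
  "AE y in \<mu> \<theta>\<^sub>0. weak_star_tendsto T (\<lambda>n. post n y) (return (restrict_space borel T) \<theta>\<^sub>0)"
proof -
  have "AE y in \<mu> \<theta>\<^sub>0. \<forall>k::nat.
    (\<lambda>n. measure (post n y) {\<theta> \<in> T. dist \<theta> \<theta>\<^sub>0 < 1 / Suc k}) \<longlonglongrightarrow> 1"
    unfolding AE_all_countable
  proof
    fix k :: nat
    obtain c where c: "0 < c" and AE: "AE y in \<mu> \<theta>\<^sub>0. \<forall>\<^sub>F n in sequentially.
      \<bar>measure (post n y) {\<theta> \<in> T. dist \<theta> \<theta>\<^sub>0 < 1 / Suc k} - 1\<bar> \<le> exp (- c * real n)"
      using posterior_concentrates[of "1 / Suc k"] by auto
    have lim: "(\<lambda>n. exp (- c * real n)) \<longlonglongrightarrow> 0"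
    proof -
      have "(\<lambda>n. exp (- c) ^ n) \<longlonglongrightarrow> 0" using c by (intro LIMSEQ_power_zero) auto
      then show ?thesis by (simp add: exp_of_nat_mult[symmetric] mult.commute)
    qed
    from AE show "AE y in \<mu> \<theta>\<^sub>0. (\<lambda>n. measure (post n y) {\<theta> \<in> T. dist \<theta> \<theta>\<^sub>0 < 1 / Suc k}) \<longlonglongrightarrow> 1"
    proof eventually_elim
      case (elim y)
      have "(\<lambda>n. measure (post n y) {\<theta> \<in> T. dist \<theta> \<theta>\<^sub>0 < 1 / Suc k} - 1) \<longlonglongrightarrow> 0"
        by (rule Lim_null_comparison[OF _ lim]) (use elim in simp)
      then show ?case by (simp add: LIM_zero_iff)
    qed
  qed
  then show ?thesis
    using AE_space
  proof eventually_elim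
    case (elim y)
    then have y: "y \<in> X" using gibbs_measure_props(2)[OF gibbs[OF true_parameter]] by simp
    show ?case
      unfolding weak_star_tendsto_def
    proof (intro allI impI)
      fix g :: "'p \<Rightarrow> real" assume g: "continuous_on T g"
      have gm: "g \<in> borel_measurable (restrict_space borel T)"
        by (rule borel_measurable_continuous_on_restrict[OF g])
      then have gm': "g \<in> borel_measurable (post n y)" for n
        by (simp cong: measurable_cong_sets add: sets_prior)
      have "compact (g ` T)" by (rule compact_continuous_image[OF g compact_T])
      then obtain G where G: "\<And>\<theta>. \<theta> \<in> T \<Longrightarrow> \<bar>g \<theta>\<bar> \<le> G"
        using compact_imp_bounded bounded_iff by (metis imageI real_norm_def)
      have G0: "0 \<le> G" using G[OF true_parameter] by linarith
      have ret: "(\<integral>\<theta>. g \<theta> \<partial>return (restrict_space borel T) \<theta>\<^sub>0) = g \<theta>\<^sub>0"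
        using true_parameter gm by (intro integral_return) (auto simp: space_restrict_space)
      have "(\<lambda>n. \<integral>\<theta>. g \<theta> \<partial>post n y) \<longlonglongrightarrow> g \<theta>\<^sub>0"
      proof (rule LIMSEQ_I)
        fix e :: real assume e: "0 < e"
        obtain d where d: "0 < d" "\<And>\<theta>. \<theta> \<in> T \<Longrightarrow> dist \<theta> \<theta>\<^sub>0 < d \<Longrightarrow> \<bar>g \<theta> - g \<theta>\<^sub>0\<bar> < e / 2"
          using g true_parameter e unfolding continuous_on_iff dist_real_def by (meson half_gt_zero)
        obtain k where k: "1 / real (Suc k) < d" using nat_approx_posE[OF d(1)] by blast
        define E where "E = {\<theta> \<in> T. dist \<theta> \<theta>\<^sub>0 < 1 / Suc k}"
        have E: "E \<in> sets \<nu>" unfolding E_def by (rule ball_in_sets)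
        have "(\<lambda>n. e / 2 + 2 * G * (1 - measure (post n y) E)) \<longlonglongrightarrow> e / 2 + 2 * G * (1 - 1)"
          using elim(1) unfolding E_def by (intro tendsto_intros) blast
        from order_tendstoD(2)[OF this, of e]
        have "\<forall>\<^sub>F n in sequentially. e / 2 + 2 * G * (1 - measure (post n y) E) < e"
          using e by simp
        then obtain N where N: "\<And>n. N \<le> n \<Longrightarrow> e / 2 + 2 * G * (1 - measure (post n y) E) < e"
          by (auto simp: eventually_sequentially)
        show "\<exists>N. \<forall>n\<ge>N. norm ((\<integral>\<theta>. g \<theta> \<partial>post n y) - g \<theta>\<^sub>0) < e"
        proof (intro exI allI impI)
          fix n assume n: "N \<le> n"
          interpret P: prob_space "post n y" by (rule prob_space_post[OF y])
          have int: "integrable (post n y) g"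
            using G gm' by (intro P.integrable_const_bound[of _ G]) (auto simp: space_post)
          have E': "space (post n y) - E \<in> sets (post n y)"
            using sets.compl_sets[of E "post n y"] E by simp
          have int': "integrable (post n y) (\<lambda>\<theta>. e / 2 + 2 * G * indicator (space (post n y) - E) \<theta>)"
            using E' by (intro Bochner_Integration.integrable_add integrable_const integrable_mult_right integrable_real_indicator)
              (auto simp: P.emeasure_eq_measure)
          have "(\<integral>\<theta>. g \<theta> \<partial>post n y) - g \<theta>\<^sub>0 = (\<integral>\<theta>. g \<theta> - g \<theta>\<^sub>0 \<partial>post n y)"
            using int by (simp add: P.prob_space)
          also have "norm \<dots> \<le> (\<integral>\<theta>. \<bar>g \<theta> - g \<theta>\<^sub>0\<bar> \<partial>post n y)"
            using integral_norm_bound[of "post n y" "\<lambda>\<theta>. g \<theta> - g \<theta>\<^sub>0"] by simp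
          also have "\<dots> \<le> (\<integral>\<theta>. e / 2 + 2 * G * indicator (space (post n y) - E) \<theta> \<partial>post n y)"
          proof (rule integral_mono[OF _ int'])
            show "integrable (post n y) (\<lambda>\<theta>. \<bar>g \<theta> - g \<theta>\<^sub>0\<bar>)" using int by simp
            fix \<theta> assume "\<theta> \<in> space (post n y)"
            then have \<theta>: "\<theta> \<in> T" by (simp add: space_post)
            show "\<bar>g \<theta> - g \<theta>\<^sub>0\<bar> \<le> e / 2 + 2 * G * indicator (space (post n y) - E) \<theta>"
            proof (cases "\<theta> \<in> E")
              case True
              then have "\<bar>g \<theta> - g \<theta>\<^sub>0\<bar> < e / 2" using k \<theta> by (intro d(2)) (auto simp: E_def)
              then show ?thesis using True by simp
            next
              case False
              have "\<bar>g \<theta> - g \<theta>\<^sub>0\<bar> \<le> 2 * G" using G[OF \<theta>] G[OF true_parameter] by linarith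
              then show ?thesis using False \<theta> e by (simp add: space_post)
            qed
          qed
          also have "\<dots> = e / 2 + 2 * G * measure (post n y) (space (post n y) - E)"
            using E' by (subst Bochner_Integration.integral_add)
              (auto simp: P.prob_space P.emeasure_eq_measure intro!: integrable_real_indicator integrable_mult_right)
          also have "\<dots> = e / 2 + 2 * G * (1 - measure (post n y) E)"
            using P.prob_compl[of E] E by simp
          also have "\<dots> < e" by (rule N[OF n])
          finally show "norm ((\<integral>\<theta>. g \<theta> \<partial>post n y) - g \<theta>\<^sub>0) < e" .
        qed
      qed
      then show "(\<lambda>n. \<integral>\<theta>. g \<theta> \<partial>post n y) \<longlonglongrightarrow> (\<integral>\<theta>. g \<theta> \<partial>return (restrict_space borel T) \<theta>\<^sub>0)"
        unfolding ret .
    qed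
  qed
qed

end

section \<open>Priors with a positive density on a box\<close>

text \<open>The box must have interior, since otherwise it would be a Lebesgue null set and could not carry a
  probability density. A point of a box with interior is a limit of interior points, so each ball
  around it meets the box in a set of positive Lebesgue measure, where the density is positive.\<close>

lemma prior_ball_pos_of_density:
  fixes a b \<theta>\<^sub>0 :: "'a::euclidean_space"
  assumes \<rho>: "continuous_on (cbox a b) \<rho>" "\<And>\<theta>. \<theta> \<in> cbox a b \<Longrightarrow> \<rho> \<theta> > 0"
    and P: "P = density (restrict_space lborel (cbox a b)) (\<lambda>\<theta>. ennreal (\<rho> \<theta>))" "prob_space P"
    and \<theta>\<^sub>0: "\<theta>\<^sub>0 \<in> cbox a b" and d: "0 < d"
  shows "0 < measure P {\<theta> \<in> cbox a b. dist \<theta> \<theta>\<^sub>0 < d}"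
proof -
  interpret prob_space P by (rule P)
  let ?R = "restrict_space lborel (cbox a b)"
  define S where "S = {\<theta> \<in> cbox a b. dist \<theta> \<theta>\<^sub>0 < d}"
  have spR: "space ?R = cbox a b" by (simp add: space_restrict_space)
  have S_eq: "S = cbox a b \<inter> ball \<theta>\<^sub>0 d" by (auto simp: S_def dist_commute)
  have S: "S \<in> sets ?R" unfolding S_eq by (simp add: sets_restrict_space)
  have "\<rho> \<in> borel_measurable (restrict_space borel (cbox a b))"
    by (rule borel_measurable_continuous_on_restrict[OF \<rho>(1)])
  then have \<rho>m: "\<rho> \<in> borel_measurable ?R"
    using sets_restrict_space_cong[of borel lborel "cbox a b"] by (simp cong: measurable_cong_sets)
  have lebesgue_R: "emeasure ?R E = emeasure lborel E" if "E \<subseteq> cbox a b" for E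
    by (rule emeasure_restrict_space) (use that in auto)
  have "box a b \<noteq> {}"
  proof
    assume "box a b = {}"
    then obtain i where i: "i \<in> Basis" "b \<bullet> i \<le> a \<bullet> i" by (auto simp: box_eq_empty)
    have flat: "(\<Prod>x\<in>Basis. (b - a) \<bullet> x) = 0" if "\<forall>x\<in>Basis. a \<bullet> x \<le> b \<bullet> x"
      using i that by (intro prod_zero bexI[of _ i]) (auto simp: inner_diff_left intro: antisym)
    have "emeasure lborel (cbox a b) = 0"
    proof (cases "\<forall>x\<in>Basis. a \<bullet> x \<le> b \<bullet> x")
      case True
      show ?thesis unfolding emeasure_lborel_cbox_eq if_P[OF True] flat[OF True] by simp
    next
      case False
      show ?thesis unfolding emeasure_lborel_cbox_eq if_not_P[OF False] by simp
    qed
    then have "emeasure ?R (space ?R) = 0" by (simp add: lebesgue_R spR)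
    then have "space ?R \<in> null_sets ?R" by (intro null_setsI sets.top)
    moreover have "absolutely_continuous ?R P"
      unfolding P(1) by (rule absolutely_continuousI_density) (use \<rho>m in measurable)
    ultimately have "space ?R \<in> null_sets P" by (auto simp: absolutely_continuous_def)
    moreover have "space ?R = space P" unfolding P(1) by simp
    ultimately show False using emeasure_space_1 by (auto simp: null_sets_def)
  qed
  then have "\<theta>\<^sub>0 \<in> ball \<theta>\<^sub>0 d \<inter> closure (box a b)" using \<theta>\<^sub>0 d by simp
  then have ne: "ball \<theta>\<^sub>0 d \<inter> box a b \<noteq> {}"
    using open_Int_closure_eq_empty[of "ball \<theta>\<^sub>0 d" "box a b"] by blast
  have "\<not> negligible (ball \<theta>\<^sub>0 d \<inter> box a b)"
    by (rule open_not_negligible[OF _ ne]) (auto intro: open_Int)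
  then have "emeasure lborel (ball \<theta>\<^sub>0 d \<inter> box a b) \<noteq> 0"
    unfolding negligible_iff_null_sets by (auto simp: null_sets_def)
  moreover have "emeasure lborel (ball \<theta>\<^sub>0 d \<inter> box a b) \<le> emeasure lborel S"
    unfolding S_eq by (rule emeasure_mono) (use box_subset_cbox[of a b] in auto)
  ultimately have posS: "emeasure lborel S \<noteq> 0" by auto
  have "emeasure P S \<noteq> 0"
  proof
    assume "emeasure P S = 0"
    then have "(\<integral>\<^sup>+\<theta>. ennreal (\<rho> \<theta>) * indicator S \<theta> \<partial>?R) = 0"
      unfolding P(1) using S \<rho>m by (subst (asm) emeasure_density) auto
    then have "emeasure ?R {\<theta> \<in> space ?R. ennreal (\<rho> \<theta>) * indicator S \<theta> \<noteq> 0} = 0"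
      using S \<rho>m by (subst (asm) nn_integral_0_iff) auto
    moreover have "{\<theta> \<in> space ?R. ennreal (\<rho> \<theta>) * indicator S \<theta> \<noteq> 0} = S"
      using \<rho>(2) by (fastforce simp: spR S_def indicator_def)
    ultimately show False using posS lebesgue_R[of S] by (auto simp: S_def)
  qed
  then show ?thesis
    unfolding S_def[symmetric] by (simp add: emeasure_eq_measure zero_less_measure_iff)
qed

theorem theoremA:
  fixes q :: nat and A :: "nat \<Rightarrow> nat \<Rightarrow> nat" and \<Omega> :: "(nat \<Rightarrow> nat) set"
    and a b :: "real ^ 'k" and \<Theta> :: "(real ^ 'k) set"
    and f :: "real ^ 'k \<Rightarrow> (nat \<Rightarrow> nat) \<Rightarrow> real"
    and \<mu> :: "real ^ 'k \<Rightarrow> (nat \<Rightarrow> nat) measure"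
    and \<rho> :: "real ^ 'k \<Rightarrow> real" and \<Pi>\<^sub>0 :: "(real ^ 'k) measure"
    and \<theta>\<^sub>0 :: "real ^ 'k"
  assumes zero_one: "\<forall>i\<in>{1..q}. \<forall>j\<in>{1..q}. A i j \<in> {0, 1}"
    and Omega: "\<Omega> = sft q A"
    and transitive: "topologically_transitive \<Omega>"
    and Theta: "\<Theta> = cbox a b"
    and potentials: "f \<in> \<Theta> \<rightarrow> normalized_potentials \<Omega>"
    and embedding: "embedding_map (top_of_set \<Theta>) (mtopology_of (potential_metric \<Omega>)) f"
    and gibbs: "\<And>\<theta>. \<theta> \<in> \<Theta> \<Longrightarrow> gibbs_measure \<Omega> (f \<theta>) (\<mu> \<theta>)"
    and prior_density: "continuous_on \<Theta> \<rho>" "\<And>\<theta>. \<theta> \<in> \<Theta> \<Longrightarrow> \<rho> \<theta> > 0"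
    and prior: "\<Pi>\<^sub>0 = density (restrict_space lborel \<Theta>) (\<lambda>\<theta>. ennreal (\<rho> \<theta>))" "prob_space \<Pi>\<^sub>0"
    and theta0: "\<theta>\<^sub>0 \<in> \<Theta>"
  shows "(AE y in \<mu> \<theta>\<^sub>0. weak_star_tendsto \<Theta> (\<lambda>n. posterior \<Omega> \<mu> \<Pi>\<^sub>0 n y)
            (return (restrict_space borel \<Theta>) \<theta>\<^sub>0)) \<and>
         (\<forall>\<delta>>0. \<exists>c>0. AE y in \<mu> \<theta>\<^sub>0. \<forall>\<^sub>F n in sequentially.
            \<bar>measure (posterior \<Omega> \<mu> \<Pi>\<^sub>0 n y) {\<theta> \<in> \<Theta>. dist \<theta> \<theta>\<^sub>0 < \<delta>} - 1\<bar> \<le> exp (- c * real n))"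
proof -
  interpret transitive_subshift q A \<Omega>
    by unfold_locales (fact Omega transitive)+
  interpret gibbs_family q A \<Omega> \<Theta> f \<mu> \<Pi>\<^sub>0 \<theta>\<^sub>0
  proof (rule gibbs_family.intro[OF transitive_subshift_axioms], rule gibbs_family_axioms.intro)
    show "compact \<Theta>" by (simp add: Theta compact_cbox)
    show "sets \<Pi>\<^sub>0 = sets (restrict_space borel \<Theta>)"
      unfolding prior(1) by (simp add: sets_restrict_space_cong[of lborel borel])
    show "0 < measure \<Pi>\<^sub>0 {\<theta> \<in> \<Theta>. dist \<theta> \<theta>\<^sub>0 < d}" if "0 < d" for d
      unfolding Theta
      by (rule prior_ball_pos_of_density[of a b \<rho>]) (use prior_density prior theta0 that Theta in auto)
  qed (fact potentials embedding gibbs prior(2) theta0)+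
  show ?thesis using posterior_weak_star posterior_concentrates by blast
qed

end
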